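(* Let $\mathcal{T}$ be an annotated sequential HCSP program and let $P_1,\dots,P_m$ and $Q_1,\dots,Q_n$ be assertions (formulas of real arithmetic over the program variables). If every formula in $\mathrm{VC}(\{P_1\wedge\dots\wedge P_m\}\,\mathcal{T}\,\{Q_1\wedge\dots\wedge Q_n\})$ is valid (true for all real values of its free variables), then the Hoare triple $\{P_1\wedge\dots\wedge P_m\}\,\mathcal{T}\,\{Q_1\wedge\dots\wedge Q_n\}$ holds, i.e. for every initial state satisfying $P_1\wedge\dots\wedge P_m$, every terminating execution of (the underlying HCSP program of) $\mathcal{T}$ ends in a state satisfying $Q_1\wedge\dots\wedge Q_n$.
   Context: Program states map variables to reals; all expressions are real polynomials. Sequential HCSP commands: $\mathsf{skip}$ (no change); $x:=e$; $x:=*(B)$ (assign to $x$ any value making $B$ true); $S;T$; $\mathtt{if}\ B\ \mathtt{then}\ S\ \mathtt{else}\ T$; $S\sqcup T$ (nondeterministic choice); $S^*$ (execute $S$ a nondeterministic finite number of times, possibly zero); and the ODE command $\langle\dot{\boldsymbol x}=\boldsymbol e \,\&\, D\rangle$, where $D$ has the form $p(\boldsymbol x)<0$ with $p$ a polynomial: if $D$ is false initially the command does nothing; otherwise $\boldsymbol x$ evolves along the solution of $\dot{\boldsymbol x}=\boldsymbol e$ until the first time $D$ becomes false (so the final state lies on the boundary of $D$). $\overline D$ and $\partial D$ denote the topological closure and boundary of the set defined by $D$. Annotated programs have the same syntax, except: each loop is written $\mathcal S^*\ \mathrm{invariant}\ [I_1]\dots[I_n]$; each ODE is either written $\langle\dot{\boldsymbol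 x}=\boldsymbol e\,\&\,D\rangle\ \mathrm{solution}$ (allowed only when $\boldsymbol e$ is linear in $\boldsymbol x$; then $\boldsymbol u(t,\boldsymbol x)$ denotes the unique solution with $\boldsymbol u(0,\boldsymbol x)=\boldsymbol x$), or $\langle\dot{\boldsymbol x}=\boldsymbol e\,\&\,D\rangle\ \mathrm{invariant}\ \mathsf{gvar}_1\dots\mathsf{gvar}_k,\ \mathsf{ode\_inv}_1\dots\mathsf{ode\_inv}_n$, where each $\mathsf{gvar}_i$ is $\mathrm{ghost}\ z_i\ (\dot z_i=f_i(\boldsymbol x,z_i))$ with $z_i$ a fresh variable and $f_i$ a polynomial linear in $z_i$, and each $\mathsf{ode\_inv}_j$ is one of: $[\mathsf{true}]$, $[\mathsf{false}]$, $[f=0]$, $[f\succcurlyeq 0]$, $[f\neq 0]$, $[f=0]\{\mathrm{dbx}\ g\}$, $[f\succcurlyeq 0]\{\mathrm{dbx}\ g\}$, $[f\succcurlyeq0]\{\mathrm{bc}\}$, with $f,g$ polynomials and $\succcurlyeq\in\{>,\ge\}$; $I_j$ denotes the assertion in $\mathsf{ode\_inv}_j$, and if no invariant is given, $n=1$ and $I_1=\mathsf{true}$. The semantics of an annotated program is that of the program with annotations erased. $\dot f$ denotes the Lie derivative of $f$ along $\dot{\boldsymbol x}=\boldsymbol e$ together with the ghost equations $\dot z_i=f_i$. Preconditions: $\mathrm{pre}(\mathcal S,\{Q_1,\dots,Q_n\})=\bigcup_i\mathrm{pre}(\mathcal S,Q_i)$; $\mathrm{pre}(\mathsf{skip},Q)=\{Q\}$;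 $\mathrm{pre}(x:=e,Q)=\{Q[e/x]\}$; $\mathrm{pre}(\mathcal S;\mathcal T,Q)=\mathrm{pre}(\mathcal S,\mathrm{pre}(\mathcal T,Q))$; for $\mathtt{if}\ B_1\ \mathtt{then}\ \mathcal S_1\ \mathtt{else\ if}\cdots\mathtt{else\ if}\ B_{n-1}\ \mathtt{then}\ \mathcal S_{n-1}\ \mathtt{else}\ \mathcal S_n$ it is $\{\neg(B_1\vee\dots\vee B_{i-1})\wedge B_i\to P\mid P\in\mathrm{pre}(\mathcal S_i,Q),1\le i\le n-1\}\cup\{\neg(B_1\vee\dots\vee B_{n-1})\to P\mid P\in\mathrm{pre}(\mathcal S_n,Q)\}$; $\mathrm{pre}(\mathcal S_1\sqcup\dots\sqcup\mathcal S_n,Q)=\bigcup_i\mathrm{pre}(\mathcal S_i,Q)$; $\mathrm{pre}(x:=*(B),Q)=\{B[y/x]\to Q[y/x]\}$ for a fresh $y$; $\mathrm{pre}(\mathcal S^*\ \mathrm{invariant}\ [I_1]\dots[I_n],Q)=\{I_1,\dots,I_n\}$; for an invariant-annotated ODE, $\mathrm{pre}=\{\neg D\to Q\}\cup P_{\mathrm{init}}$ with $P_{\mathrm{init}}=\{D\to\exists z_1\dots z_k.\,I_1\wedge\dots\wedge I_n\}$ if $k>0$ and $P_{\mathrm{init}}=\{D\to I_j\mid 1\le j\le n\}$ otherwise; for a solution-annotated ODE, $\mathrm{pre}=\{\neg D\to Q,\ D\to\forall t>0.\,((\forall 0\le\tau<t.\,D(\boldsymbol u(\tau,\boldsymbol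 x)))\wedge\neg D(\boldsymbol u(t,\boldsymbol x))\to Q(\boldsymbol u(t,\boldsymbol x)))\}$. Internal conditions: $\mathrm{vc}(\mathcal S,\{Q_1,\dots,Q_n\})=\bigcup_i\mathrm{vc}(\mathcal S,Q_i)$; $\mathrm{vc}$ of $\mathsf{skip}$, $x:=e$, $x:=*(B)$ and of a solution-annotated ODE is $\emptyset$; $\mathrm{vc}(\mathcal S;\mathcal T,Q)=\mathrm{vc}(\mathcal S,\mathrm{pre}(\mathcal T,Q))\cup\mathrm{vc}(\mathcal T,Q)$; $\mathrm{vc}$ of an if-chain or nondeterministic choice is $\bigcup_i\mathrm{vc}(\mathcal S_i,Q)$; $\mathrm{vc}(\mathcal S^*\ \mathrm{invariant}\ [I_1]\dots[I_n],Q)=\mathrm{vc}(\mathcal S,\{I_1,\dots,I_n\})\cup\{I_1\wedge\dots\wedge I_n\to Q\}\cup\{I_1\wedge\dots\wedge I_n\to P\mid P\in\mathrm{pre}(\mathcal S,\{I_1,\dots,I_n\})\}$; for an invariant-annotated ODE, $\mathrm{vc}=C_{\mathrm{exec}}\cup C_{\mathrm{dC}}$, where $C_{\mathrm{exec}}=\emptyset$ if the only invariant is $\mathsf{false}$ and otherwise $C_{\mathrm{exec}}=\{I_1\wedge\dots\wedge I_n\wedge\partial D\to Q\}$, and $C_{\mathrm{dC}}=\{I_1\wedge\dots\wedge I_{j-1}\to R\mid R\in V_j,1\le j\le n\}$ with $V_j$ determined by $\mathsf{ode\_inv}_j$: $\emptyset$ for $[\mathsf{true}]$ and $[\mathsf{false}]$;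 $\{\overline D\to\dot f=0\}$ for $[f=0]$ and $[f\ne0]$; $\{\overline D\to\dot f\ge0\}$ for $[f\succcurlyeq0]$; $\{\overline D\to\dot f=gf\}$ for $[f=0]\{\mathrm{dbx}\ g\}$; $\{\overline D\to\dot f\ge gf\}$ for $[f\succcurlyeq0]\{\mathrm{dbx}\ g\}$; $\{\overline D\wedge f=0\to\dot f>0\}$ for $[f\succcurlyeq0]\{\mathrm{bc}\}$. Finally $\mathrm{VC}(\{P_1\wedge\dots\wedge P_m\}\,\mathcal S\,\{Q_1\wedge\dots\wedge Q_n\})=\{P_1\wedge\dots\wedge P_m\to R\mid R\in\mathrm{pre}(\mathcal S,\{Q_1,\dots,Q_n\})\}\cup\{\tilde P_1\wedge\dots\wedge\tilde P_{\tilde m}\to R\mid R\in\mathrm{vc}(\mathcal S,\{Q_1,\dots,Q_n\})\}$, where $\tilde P_1,\dots,\tilde P_{\tilde m}$ are those $P_i$ none of whose variables is ever reassigned in $\mathcal S$ (by an assignment, a nondeterministic assignment, or an ODE). *)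

theory Defs
  imports "HOL-Analysis.Analysis"
begin

section \<open>Terms and formulas\<close>

type_synonym var = nat
type_synonym state = "var \<Rightarrow> real"

text \<open>
  Program expressions and user assertions are built without \<open>App\<close> and \<open>Rel\<close> (see \<open>is_poly\<close> and
  \<open>is_arith\<close>). These two constructors, which apply a real function or relation to terms, occur only
  in verification conditions: \<open>App\<close> for the components of the solution \<open>u(t,x)\<close> of a linear ODE,
  which need not be polynomial, and \<open>Rel\<close> for membership in the closure or boundary of a domain.
\<close>

datatype tm =
    Const real
  | Var var
  | Add tm tm
  | Sub tm tm
  | Mul tm tm
  | App "real list \<Rightarrow> real" "tm list"

datatype fm =
    TT
  | FF
  | Eq tm tm
  | Less tm tm
  | Leq tm tm
  | Rel "real list \<Rightarrow> bool" "tm list"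
  | Neg fm
  | And fm fm
  | Or fm fm
  | Imp fm fm
  | Forall var fm
  | Exists var fm

primrec teval :: "tm \<Rightarrow> state \<Rightarrow> real" where
  "teval (Const c) s = c"
| "teval (Var x) s = s x"
| "teval (Add a b) s = teval a s + teval b s"
| "teval (Sub a b) s = teval a s - teval b s"
| "teval (Mul a b) s = teval a s * teval b s"
| "teval (App g ts) s = g (map (\<lambda>t. teval t s) ts)"

primrec sat :: "fm \<Rightarrow> state \<Rightarrow> bool" where
  "sat TT s \<longleftrightarrow> True"
| "sat FF s \<longleftrightarrow> False"
| "sat (Eq a b) s \<longleftrightarrow> teval a s = teval b s"
| "sat (Less a b) s \<longleftrightarrow> teval a s < teval b s"
| "sat (Leq a b) s \<longleftrightarrow> teval a s \<le> teval b s"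
| "sat (Rel r ts) s \<longleftrightarrow> r (map (\<lambda>t. teval t s) ts)"
| "sat (Neg F) s \<longleftrightarrow> \<not> sat F s"
| "sat (And F G) s \<longleftrightarrow> sat F s \<and> sat G s"
| "sat (Or F G) s \<longleftrightarrow> sat F s \<or> sat G s"
| "sat (Imp F G) s \<longleftrightarrow> (sat F s \<longrightarrow> sat G s)"
| "sat (Forall x F) s \<longleftrightarrow> (\<forall>v. sat F (s(x := v)))"
| "sat (Exists x F) s \<longleftrightarrow> (\<exists>v. sat F (s(x := v)))"

definition valid :: "fm \<Rightarrow> bool" where
  "valid F \<longleftrightarrow> (\<forall>s. sat F s)"

primrec tvars :: "tm \<Rightarrow> var set" where
  "tvars (Const c) = {}"
| "tvars (Var x) = {x}"
| "tvars (Add a b) = tvars a \<union> tvars b"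
| "tvars (Sub a b) = tvars a \<union> tvars b"
| "tvars (Mul a b) = tvars a \<union> tvars b"
| "tvars (App g ts) = \<Union>(set (map tvars ts))"

text \<open>The free variables of a formula.\<close>

primrec fv :: "fm \<Rightarrow> var set" where
  "fv TT = {}"
| "fv FF = {}"
| "fv (Eq a b) = tvars a \<union> tvars b"
| "fv (Less a b) = tvars a \<union> tvars b"
| "fv (Leq a b) = tvars a \<union> tvars b"
| "fv (Rel r ts) = (\<Union>t\<in>set ts. tvars t)"
| "fv (Neg F) = fv F"
| "fv (And F G) = fv F \<union> fv G"
| "fv (Or F G) = fv F \<union> fv G"
| "fv (Imp F G) = fv F \<union> fv G"
| "fv (Forall x F) = fv F - {x}"
| "fv (Exists x F) = fv F - {x}"

primrec is_poly :: "tm \<Rightarrow> bool" where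
  "is_poly (Const c) \<longleftrightarrow> True"
| "is_poly (Var x) \<longleftrightarrow> True"
| "is_poly (Add a b) \<longleftrightarrow> is_poly a \<and> is_poly b"
| "is_poly (Sub a b) \<longleftrightarrow> is_poly a \<and> is_poly b"
| "is_poly (Mul a b) \<longleftrightarrow> is_poly a \<and> is_poly b"
| "is_poly (App g ts) \<longleftrightarrow> False"

text \<open>Formulas of real arithmetic.\<close>

primrec is_arith :: "fm \<Rightarrow> bool" where
  "is_arith TT \<longleftrightarrow> True"
| "is_arith FF \<longleftrightarrow> True"
| "is_arith (Eq a b) \<longleftrightarrow> is_poly a \<and> is_poly b"
| "is_arith (Less a b) \<longleftrightarrow> is_poly a \<and> is_poly b"
| "is_arith (Leq a b) \<longleftrightarrow> is_poly a \<and> is_poly b"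
| "is_arith (Rel r ts) \<longleftrightarrow> False"
| "is_arith (Neg F) \<longleftrightarrow> is_arith F"
| "is_arith (And F G) \<longleftrightarrow> is_arith F \<and> is_arith G"
| "is_arith (Or F G) \<longleftrightarrow> is_arith F \<and> is_arith G"
| "is_arith (Imp F G) \<longleftrightarrow> is_arith F \<and> is_arith G"
| "is_arith (Forall x F) \<longleftrightarrow> is_arith F"
| "is_arith (Exists x F) \<longleftrightarrow> is_arith F"

text \<open>All uses below have a finite argument, so that a fresh variable exists.\<close>

definition fresh :: "var set \<Rightarrow> var" where
  "fresh W = (SOME y. y \<notin> W)"

primrec tsubst :: "(var \<Rightarrow> tm) \<Rightarrow> tm \<Rightarrow> tm" where
  "tsubst \<sigma> (Const c) = Const c"
| "tsubst \<sigma> (Var x) = \<sigma> x"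
| "tsubst \<sigma> (Add a b) = Add (tsubst \<sigma> a) (tsubst \<sigma> b)"
| "tsubst \<sigma> (Sub a b) = Sub (tsubst \<sigma> a) (tsubst \<sigma> b)"
| "tsubst \<sigma> (Mul a b) = Mul (tsubst \<sigma> a) (tsubst \<sigma> b)"
| "tsubst \<sigma> (App g ts) = App g (map (tsubst \<sigma>) ts)"

text \<open>Simultaneous capture-avoiding substitution; bound variables are always renamed.\<close>

primrec fsubst :: "(var \<Rightarrow> tm) \<Rightarrow> fm \<Rightarrow> fm" where
  "fsubst \<sigma> TT = TT"
| "fsubst \<sigma> FF = FF"
| "fsubst \<sigma> (Eq a b) = Eq (tsubst \<sigma> a) (tsubst \<sigma> b)"
| "fsubst \<sigma> (Less a b) = Less (tsubst \<sigma> a) (tsubst \<sigma> b)"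
| "fsubst \<sigma> (Leq a b) = Leq (tsubst \<sigma> a) (tsubst \<sigma> b)"
| "fsubst \<sigma> (Rel r ts) = Rel r (map (tsubst \<sigma>) ts)"
| "fsubst \<sigma> (Neg F) = Neg (fsubst \<sigma> F)"
| "fsubst \<sigma> (And F G) = And (fsubst \<sigma> F) (fsubst \<sigma> G)"
| "fsubst \<sigma> (Or F G) = Or (fsubst \<sigma> F) (fsubst \<sigma> G)"
| "fsubst \<sigma> (Imp F G) = Imp (fsubst \<sigma> F) (fsubst \<sigma> G)"
| "fsubst \<sigma> (Forall x F) =
     (let y = fresh (\<Union>v\<in>fv F - {x}. tvars (\<sigma> v)) in Forall y (fsubst (\<sigma>(x := Var y)) F))"
| "fsubst \<sigma> (Exists x F) =
     (let y = fresh (\<Union>v\<in>fv F - {x}. tvars (\<sigma> v)) in Exists y (fsubst (\<sigma>(x := Var y)) F))"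

text \<open>\<open>subst1 Q e x\<close> is \<open>Q[e/x]\<close>.\<close>

definition subst1 :: "fm \<Rightarrow> tm \<Rightarrow> var \<Rightarrow> fm" where
  "subst1 Q e x = fsubst (Var(x := e)) Q"

definition Conj :: "fm list \<Rightarrow> fm" where
  "Conj Fs = foldr And Fs TT"

definition Disj :: "fm list \<Rightarrow> fm" where
  "Disj Fs = foldr Or Fs FF"

section \<open>Sequential hybrid programs\<close>

text \<open>
  A system of equations \<open>x' = e\<close> is a list of pairs \<open>(x, e)\<close>; variables without an equation stay
  constant. The command \<open>Ode E p\<close> has the domain \<open>p < 0\<close>.
\<close>

type_synonym ode = "(var \<times> tm) list"

datatype prog =
    Skip
  | Assign var tm
  | Havoc var fm
  | Seq prog prog
  | If fm prog prog
  | Choice prog prog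
  | Star prog
  | Ode ode tm

definition ode_sol :: "ode \<Rightarrow> state \<Rightarrow> real \<Rightarrow> (real \<Rightarrow> state) \<Rightarrow> bool" where
  "ode_sol E s T f \<longleftrightarrow> f 0 = s \<and>
     (\<forall>t\<in>{0..T}.
        (\<forall>(x, e)\<in>set E. ((\<lambda>r. f r x) has_real_derivative teval e (f t)) (at t within {0..T})) \<and>
        (\<forall>x. x \<notin> fst ` set E \<longrightarrow> f t x = s x))"

inductive exec :: "prog \<Rightarrow> state \<Rightarrow> state \<Rightarrow> bool" where
  Skip: "exec Skip s s"
| Assign: "exec (Assign x e) s (s(x := teval e s))"
| Havoc: "sat B (s(x := v)) \<Longrightarrow> exec (Havoc x B) s (s(x := v))"
| Seq: "exec S s s' \<Longrightarrow> exec T s' s'' \<Longrightarrow> exec (Seq S T) s s''"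
| IfTrue: "sat B s \<Longrightarrow> exec S s s' \<Longrightarrow> exec (If B S T) s s'"
| IfFalse: "\<not> sat B s \<Longrightarrow> exec T s s' \<Longrightarrow> exec (If B S T) s s'"
| ChoiceL: "exec S s s' \<Longrightarrow> exec (Choice S T) s s'"
| ChoiceR: "exec T s s' \<Longrightarrow> exec (Choice S T) s s'"
| StarStop: "exec (Star S) s s"
| StarStep: "exec S s s' \<Longrightarrow> exec (Star S) s' s'' \<Longrightarrow> exec (Star S) s s''"
| OdeSkip: "\<not> teval p s < 0 \<Longrightarrow> exec (Ode E p) s s"
| OdeRun: "T > 0 \<Longrightarrow> ode_sol E s T f \<Longrightarrow> (\<forall>t\<in>{0..<T}. teval p (f t) < 0) \<Longrightarrow>
    \<not> teval p (f T) < 0 \<Longrightarrow> exec (Ode E p) s (f T)"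

definition hoare :: "fm \<Rightarrow> prog \<Rightarrow> fm \<Rightarrow> bool" where
  "hoare P S Q \<longleftrightarrow> (\<forall>s s'. sat P s \<longrightarrow> exec S s s' \<longrightarrow> sat Q s')"

section \<open>Annotated programs\<close>

datatype ineq = Gt | Ge

datatype ode_inv =
    InvTrue
  | InvFalse
  | InvEq tm
  | InvIneq ineq tm
  | InvNeq tm
  | DbxEq tm tm         \<comment> \<open>\<open>DbxEq f g\<close> is \<open>[f = 0]{dbx g}\<close>\<close>
  | DbxIneq ineq tm tm
  | BcIneq ineq tm

text \<open>
  \<open>ACond [(B1, S1), \<dots>] S\<close> is the chain \<open>if B1 then S1 else if \<dots> else S\<close>. In \<open>AOdeInv E p gs is\<close>,
  \<open>gs\<close> lists the ghost equations.
\<close>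

datatype aprog =
    ASkip
  | AAssign var tm
  | AHavoc var fm
  | ASeq aprog aprog
  | ACond "(fm \<times> aprog) list" aprog
  | AChoice aprog aprog
  | AStar aprog "fm list"
  | AOdeSol ode tm
  | AOdeInv ode tm ode "ode_inv list"

fun erase :: "aprog \<Rightarrow> prog" where
  "erase ASkip = Skip"
| "erase (AAssign x e) = Assign x e"
| "erase (AHavoc x B) = Havoc x B"
| "erase (ASeq S T) = Seq (erase S) (erase T)"
| "erase (ACond bs S) = foldr (\<lambda>(B, R). If B R) (map (\<lambda>(B, R). (B, erase R)) bs) (erase S)"
| "erase (AChoice S T) = Choice (erase S) (erase T)"
| "erase (AStar S Is) = Star (erase S)"
| "erase (AOdeSol E p) = Ode E p"
| "erase (AOdeInv E p gs is) = Ode E p"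

fun ineq_fm :: "ineq \<Rightarrow> tm \<Rightarrow> fm" where
  "ineq_fm Gt f = Less (Const 0) f"
| "ineq_fm Ge f = Leq (Const 0) f"

fun inv_fm :: "ode_inv \<Rightarrow> fm" where
  "inv_fm InvTrue = TT"
| "inv_fm InvFalse = FF"
| "inv_fm (InvEq f) = Eq f (Const 0)"
| "inv_fm (InvIneq c f) = ineq_fm c f"
| "inv_fm (InvNeq f) = Neg (Eq f (Const 0))"
| "inv_fm (DbxEq f g) = Eq f (Const 0)"
| "inv_fm (DbxIneq c f g) = ineq_fm c f"
| "inv_fm (BcIneq c f) = ineq_fm c f"

text \<open>All polynomials in an annotation, including the cofactors \<open>g\<close> of \<open>dbx\<close>.\<close>

fun inv_tms :: "ode_inv \<Rightarrow> tm set" where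
  "inv_tms InvTrue = {}"
| "inv_tms InvFalse = {}"
| "inv_tms (InvEq f) = {f}"
| "inv_tms (InvIneq c f) = {f}"
| "inv_tms (InvNeq f) = {f}"
| "inv_tms (DbxEq f g) = {f, g}"
| "inv_tms (DbxIneq c f g) = {f, g}"
| "inv_tms (BcIneq c f) = {f}"

definition ode_vars :: "ode \<Rightarrow> var set" where
  "ode_vars E = (\<Union>(x, e)\<in>set E. insert x (tvars e))"

text \<open>
  The variables of an annotated program. Ghost variables are local to the ODE declaring them and
  are not counted; they are collected by \<open>ghosts\<close>.
\<close>

fun avars :: "aprog \<Rightarrow> var set" where
  "avars ASkip = {}"
| "avars (AAssign x e) = insert x (tvars e)"
| "avars (AHavoc x B) = insert x (fv B)"
| "avars (ASeq S T) = avars S \<union> avars T"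
| "avars (ACond bs S) = (\<Union>(B, R)\<in>set bs. fv B \<union> avars R) \<union> avars S"
| "avars (AChoice S T) = avars S \<union> avars T"
| "avars (AStar S Is) = avars S \<union> (\<Union>I\<in>set Is. fv I)"
| "avars (AOdeSol E p) = ode_vars E \<union> tvars p"
| "avars (AOdeInv E p gs is) = ode_vars E \<union> tvars p \<union>
     ((ode_vars gs \<union> (\<Union>i\<in>set is. \<Union>f\<in>inv_tms i. tvars f)) - fst ` set gs)"

fun ghosts :: "aprog \<Rightarrow> var set" where
  "ghosts (ASeq S T) = ghosts S \<union> ghosts T"
| "ghosts (ACond bs S) = (\<Union>(B, R)\<in>set bs. ghosts R) \<union> ghosts S"
| "ghosts (AChoice S T) = ghosts S \<union> ghosts T"
| "ghosts (AStar S Is) = ghosts S"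
| "ghosts (AOdeInv E p gs is) = fst ` set gs"
| "ghosts _ = {}"

text \<open>The variables that are reassigned somewhere in a program.\<close>

fun assigned :: "aprog \<Rightarrow> var set" where
  "assigned ASkip = {}"
| "assigned (AAssign x e) = {x}"
| "assigned (AHavoc x B) = {x}"
| "assigned (ASeq S T) = assigned S \<union> assigned T"
| "assigned (ACond bs S) = (\<Union>(B, R)\<in>set bs. assigned R) \<union> assigned S"
| "assigned (AChoice S T) = assigned S \<union> assigned T"
| "assigned (AStar S Is) = assigned S"
| "assigned (AOdeSol E p) = fst ` set E"
| "assigned (AOdeInv E p gs is) = fst ` set E"

text \<open>
  Linearity is understood in the affine sense; the coefficients are polynomials in the variables
  other than \<open>xs\<close>.
\<close>

definition linear_in :: "var list \<Rightarrow> tm \<Rightarrow> bool" where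
  "linear_in xs e \<longleftrightarrow> (\<exists>c b. is_poly b \<and> tvars b \<inter> set xs = {} \<and>
     (\<forall>x\<in>set xs. is_poly (c x) \<and> tvars (c x) \<inter> set xs = {}) \<and>
     (\<forall>s. teval e s = (\<Sum>x\<in>set xs. teval (c x) s * s x) + teval b s))"

definition wf_ode :: "ode \<Rightarrow> bool" where
  "wf_ode E \<longleftrightarrow> distinct (map fst E) \<and> (\<forall>(x, e)\<in>set E. is_poly e)"

fun wf_aprog :: "aprog \<Rightarrow> bool" where
  "wf_aprog ASkip \<longleftrightarrow> True"
| "wf_aprog (AAssign x e) \<longleftrightarrow> is_poly e"
| "wf_aprog (AHavoc x B) \<longleftrightarrow> is_arith B"
| "wf_aprog (ASeq S T) \<longleftrightarrow> wf_aprog S \<and> wf_aprog T"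
| "wf_aprog (ACond bs S) \<longleftrightarrow> bs \<noteq> [] \<and> (\<forall>(B, R)\<in>set bs. is_arith B \<and> wf_aprog R) \<and> wf_aprog S"
| "wf_aprog (AChoice S T) \<longleftrightarrow> wf_aprog S \<and> wf_aprog T"
| "wf_aprog (AStar S Is) \<longleftrightarrow> wf_aprog S \<and> Is \<noteq> [] \<and> (\<forall>I\<in>set Is. is_arith I)"
| "wf_aprog (AOdeSol E p) \<longleftrightarrow> wf_ode E \<and> is_poly p \<and> (\<forall>(x, e)\<in>set E. linear_in (map fst E) e)"
| "wf_aprog (AOdeInv E p gs is) \<longleftrightarrow> wf_ode E \<and> is_poly p \<and>
     wf_ode gs \<and>
     (\<forall>(z, f)\<in>set gs. linear_in [z] f \<and> tvars f \<inter> fst ` set gs \<subseteq> {z}) \<and>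
     (\<forall>i\<in>set is. \<forall>f\<in>inv_tms i. is_poly f)"

text \<open>
  Freshness of the ghost variables is a condition on the whole triple: they occur neither in the
  assertions nor in the program outside the annotation of the ODE declaring them.
\<close>

definition wf_triple :: "fm list \<Rightarrow> aprog \<Rightarrow> fm list \<Rightarrow> bool" where
  "wf_triple Ps T Qs \<longleftrightarrow> wf_aprog T \<and> (\<forall>P\<in>set Ps. is_arith P) \<and> (\<forall>Q\<in>set Qs. is_arith Q) \<and>
     ghosts T \<inter> (avars T \<union> (\<Union>P\<in>set Ps. fv P) \<union> (\<Union>Q\<in>set Qs. fv Q)) = {}"

section \<open>Lie derivatives, solutions, closures and boundaries\<close>

text \<open>Partial derivative of a polynomial; the value on \<open>App\<close> is a dummy.\<close>

primrec pd :: "var \<Rightarrow> tm \<Rightarrow> tm" where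
  "pd x (Const c) = Const 0"
| "pd x (Var y) = Const (if x = y then 1 else 0)"
| "pd x (Add a b) = Add (pd x a) (pd x b)"
| "pd x (Sub a b) = Sub (pd x a) (pd x b)"
| "pd x (Mul a b) = Add (Mul (pd x a) b) (Mul a (pd x b))"
| "pd x (App g ts) = Const 0"

definition lie :: "ode \<Rightarrow> tm \<Rightarrow> tm" where
  "lie E f = foldr (\<lambda>(x, e) r. Add (Mul (pd x f) e) r) E (Const 0)"

text \<open>For \<open>t \<ge> 0\<close>, the state reached at time \<open>t\<close> by the solution starting in \<open>s\<close>.\<close>

definition flow :: "ode \<Rightarrow> real \<Rightarrow> state \<Rightarrow> state" where
  "flow E t s = (THE s'. \<exists>f. ode_sol E s t f \<and> f t = s')"

definition state_of :: "var list \<Rightarrow> real list \<Rightarrow> state" where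
  "state_of xs vs = (\<lambda>x. case map_of (zip xs vs) x of Some v \<Rightarrow> v | None \<Rightarrow> 0)"

text \<open>The term for the component \<open>x\<close> of \<open>u(t,x)\<close>, for a variable \<open>x\<close> evolving under \<open>E\<close>.\<close>

definition sol_tm :: "ode \<Rightarrow> tm \<Rightarrow> var \<Rightarrow> tm" where
  "sol_tm E t x = (let xs = sorted_list_of_set (ode_vars E) in
     App (\<lambda>vs. flow E (hd vs) (state_of xs (tl vs)) x) (t # map Var xs))"

definition at_sol :: "ode \<Rightarrow> tm \<Rightarrow> fm \<Rightarrow> fm" where
  "at_sol E t Q = fsubst (\<lambda>x. if x \<in> fst ` set E then sol_tm E t x else Var x) Q"

definition dom_fm :: "tm \<Rightarrow> fm" where
  "dom_fm p = Less p (Const 0)"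

text \<open>
  Closure and boundary of a domain are taken in the space of all states with the product topology.
  Since the domain only restricts the finitely many variables of \<open>p\<close>, this amounts to taking them
  in the Euclidean space of these variables.
\<close>

definition closure_fm :: "tm \<Rightarrow> fm" where
  "closure_fm p = (let xs = sorted_list_of_set (tvars p) in
     Rel (\<lambda>vs. state_of xs vs \<in> closure {s. sat (dom_fm p) s}) (map Var xs))"

definition boundary_fm :: "tm \<Rightarrow> fm" where
  "boundary_fm p = (let xs = sorted_list_of_set (tvars p) in
     Rel (\<lambda>vs. state_of xs vs \<in> frontier {s. sat (dom_fm p) s}) (map Var xs))"

section \<open>Verification conditions\<close>

definition the_invs :: "ode_inv list \<Rightarrow> ode_inv list" where
  "the_invs is = (if is = [] then [InvTrue] else is)"

definition ode_init :: "tm \<Rightarrow> ode \<Rightarrow> ode_inv list \<Rightarrow> fm set" where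
  "ode_init p gs is =
     (if gs \<noteq> [] then {Imp (dom_fm p) (foldr Exists (map fst gs) (Conj (map inv_fm is)))}
      else {Imp (dom_fm p) (inv_fm i) | i. i \<in> set is})"

definition if_pre :: "(fm \<times> fm set) list \<Rightarrow> fm set \<Rightarrow> fm set" where
  "if_pre bs Fs =
     {Imp (And (Neg (Disj (map fst (take i bs)))) (fst (bs ! i))) P | i P.
        i < length bs \<and> P \<in> snd (bs ! i)} \<union>
     {Imp (Neg (Disj (map fst bs))) P | P. P \<in> Fs}"

text \<open>
  \<open>W\<close> is the set of all variables in use. The variable chosen for \<open>x :=* (B)\<close> remains free in the
  verification conditions and must be fresh for the whole triple, not just for \<open>B\<close> and \<open>Q\<close>.
\<close>

fun pre :: "var set \<Rightarrow> aprog \<Rightarrow> fm \<Rightarrow> fm set" where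
  "pre W ASkip Q = {Q}"
| "pre W (AAssign x e) Q = {subst1 Q e x}"
| "pre W (AHavoc x B) Q =
     (let y = fresh (W \<union> {x} \<union> fv B \<union> fv Q) in {Imp (subst1 B (Var y) x) (subst1 Q (Var y) x)})"
| "pre W (ASeq S T) Q = (\<Union>R\<in>pre W T Q. pre W S R)"
| "pre W (ACond bs S) Q = if_pre (map (\<lambda>(B, R). (B, pre W R Q)) bs) (pre W S Q)"
| "pre W (AChoice S T) Q = pre W S Q \<union> pre W T Q"
| "pre W (AStar S Is) Q = set Is"
| "pre W (AOdeSol E p) Q =
     (let t = fresh (W \<union> ode_vars E \<union> tvars p \<union> fv Q);
          r = fresh (W \<union> ode_vars E \<union> tvars p \<union> fv Q \<union> {t})
      in {Imp (Neg (dom_fm p)) Q,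
          Imp (dom_fm p)
            (Forall t (Imp (Less (Const 0) (Var t))
              (Imp
                (And
                  (Forall r (Imp (And (Leq (Const 0) (Var r)) (Less (Var r) (Var t)))
                    (at_sol E (Var r) (dom_fm p))))
                  (Neg (at_sol E (Var t) (dom_fm p))))
                (at_sol E (Var t) Q))))})"
| "pre W (AOdeInv E p gs is) Q =
     {Imp (Neg (dom_fm p)) Q} \<union> ode_init p gs (the_invs is)"

definition pres :: "var set \<Rightarrow> aprog \<Rightarrow> fm set \<Rightarrow> fm set" where
  "pres W S Qs = (\<Union>Q\<in>Qs. pre W S Q)"

text \<open>Here \<open>E\<close> includes the ghost equations.\<close>

fun inv_conds :: "ode \<Rightarrow> tm \<Rightarrow> ode_inv \<Rightarrow> fm set" where
  "inv_conds E p InvTrue = {}"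
| "inv_conds E p InvFalse = {}"
| "inv_conds E p (InvEq f) = {Imp (closure_fm p) (Eq (lie E f) (Const 0))}"
| "inv_conds E p (InvNeq f) = {Imp (closure_fm p) (Eq (lie E f) (Const 0))}"
| "inv_conds E p (InvIneq c f) = {Imp (closure_fm p) (Leq (Const 0) (lie E f))}"
| "inv_conds E p (DbxEq f g) = {Imp (closure_fm p) (Eq (lie E f) (Mul g f))}"
| "inv_conds E p (DbxIneq c f g) = {Imp (closure_fm p) (Leq (Mul g f) (lie E f))}"
| "inv_conds E p (BcIneq c f) =
     {Imp (And (closure_fm p) (Eq f (Const 0))) (Less (Const 0) (lie E f))}"

definition C_exec :: "tm \<Rightarrow> ode_inv list \<Rightarrow> fm \<Rightarrow> fm set" where
  "C_exec p is Q =
     (if is = [InvFalse] then {} else {Imp (And (Conj (map inv_fm is)) (boundary_fm p)) Q})"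

definition C_dC :: "ode \<Rightarrow> tm \<Rightarrow> ode_inv list \<Rightarrow> fm set" where
  "C_dC E p is =
     {Imp (Conj (map inv_fm (take j is))) R | j R. j < length is \<and> R \<in> inv_conds E p (is ! j)}"

fun vc :: "var set \<Rightarrow> aprog \<Rightarrow> fm \<Rightarrow> fm set" where
  "vc W ASkip Q = {}"
| "vc W (AAssign x e) Q = {}"
| "vc W (AHavoc x B) Q = {}"
| "vc W (ASeq S T) Q = (\<Union>R\<in>pre W T Q. vc W S R) \<union> vc W T Q"
| "vc W (ACond bs S) Q = (\<Union>(B, R)\<in>set bs. vc W R Q) \<union> vc W S Q"
| "vc W (AChoice S T) Q = vc W S Q \<union> vc W T Q"
| "vc W (AStar S Is) Q =
     (\<Union>I\<in>set Is. vc W S I) \<union> {Imp (Conj Is) Q} \<union>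
     {Imp (Conj Is) P | P. P \<in> pres W S (set Is)}"
| "vc W (AOdeSol E p) Q = {}"
| "vc W (AOdeInv E p gs is) Q =
     C_exec p (the_invs is) Q \<union> C_dC (E @ gs) p (the_invs is)"

definition vcs :: "var set \<Rightarrow> aprog \<Rightarrow> fm set \<Rightarrow> fm set" where
  "vcs W S Qs = (\<Union>Q\<in>Qs. vc W S Q)"

definition VC :: "fm list \<Rightarrow> aprog \<Rightarrow> fm list \<Rightarrow> fm set" where
  "VC Ps S Qs =
     (let W = avars S \<union> ghosts S \<union> (\<Union>P\<in>set Ps. fv P) \<union> (\<Union>Q\<in>set Qs. fv Q) in
      {Imp (Conj Ps) R | R. R \<in> pres W S (set Qs)} \<union>
      {Imp (Conj (filter (\<lambda>P. fv P \<inter> assigned S = {}) Ps)) R | R. R \<in> vcs W S (set Qs)})"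

end

theory Submission imports Defs
begin

text \<open>
  Soundness is an induction on the program, for one postcondition at a time. The variable chosen
  for \<open>x :=* (B)\<close> stays free in the preconditions and must be read universally, so an assertion is
  required to hold in all states agreeing with the current one on the set \<open>W\<close> of variables in use.

  For an invariant-annotated ODE, each ghost equation is linear in its own ghost and contains no
  other, so the ghosts can be solved along the given run by an integrating factor. On the resulting
  trajectory the invariants hold one after the other: integrating factors turn the \<open>dbx\<close> rules (and,
  with cofactor 0, the Lie derivative rules) into monotonicity, and the barrier rule follows by
  looking at an extremal zero. For a solution-annotated ODE one needs that \<open>flow\<close> is the given run,
  i.e. uniqueness for linear systems, a Gronwall argument for the squared distance of two solutions.
\<close>

section \<open>Syntax\<close>

lemma finite_tvars [simp]: "finite (tvars t)"
  by (induction t) auto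

lemma finite_fv [simp]: "finite (fv F)"
  by (induction F) auto

lemma finite_ode_vars [simp]: "finite (ode_vars E)"
  by (auto simp: ode_vars_def)

lemma finite_inv_tms [simp]: "finite (inv_tms i)"
  by (cases i) auto

lemma finite_avars [simp]: "finite (avars S)"
  by (induction S) fastforce+

lemma finite_ghosts [simp]: "finite (ghosts S)"
  by (induction S) fastforce+

lemma fresh_notin: "finite W \<Longrightarrow> fresh W \<notin> W"
  unfolding fresh_def by (rule someI_ex) (rule ex_new_if_finite, auto)

lemma teval_cong: "(\<And>x. x \<in> tvars t \<Longrightarrow> r x = s x) \<Longrightarrow> teval t r = teval t s"
proof (induction t)
  case (App g ts)
  then have "map (\<lambda>t. teval t r) ts = map (\<lambda>t. teval t s) ts"
    by (intro map_cong) auto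
  then show ?case by (simp only: teval.simps)
next
  case (Add a b)
  then have "teval a r = teval a s" "teval b r = teval b s" by auto
  then show ?case by simp
next
  case (Sub a b)
  then have "teval a r = teval a s" "teval b r = teval b s" by auto
  then show ?case by simp
next
  case (Mul a b)
  then have "teval a r = teval a s" "teval b r = teval b s" by auto
  then show ?case by simp
qed auto

lemma map_teval_cong:
  "(\<And>x. x \<in> (\<Union>t\<in>set ts. tvars t) \<Longrightarrow> r x = s x) \<Longrightarrow> map (\<lambda>t. teval t r) ts = map (\<lambda>t. teval t s) ts"
  by (intro map_cong) (auto intro: teval_cong)

lemma sat_cong: "(\<And>x. x \<in> fv F \<Longrightarrow> r x = s x) \<Longrightarrow> sat F r \<longleftrightarrow> sat F s"
proof (induction F arbitrary: r s)
  case (Eq a b)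
  then have "teval a r = teval a s" "teval b r = teval b s" by (auto intro!: teval_cong)
  then show ?case by simp
next
  case (Less a b)
  then have "teval a r = teval a s" "teval b r = teval b s" by (auto intro!: teval_cong)
  then show ?case by simp
next
  case (Leq a b)
  then have "teval a r = teval a s" "teval b r = teval b s" by (auto intro!: teval_cong)
  then show ?case by simp
next
  case (Rel q ts)
  then have "map (\<lambda>t. teval t r) ts = map (\<lambda>t. teval t s) ts"
    by (intro map_teval_cong) auto
  then show ?case by (simp only: sat.simps)
next
  case (Neg F)
  have "sat F r \<longleftrightarrow> sat F s" using Neg.prems by (intro Neg.IH) auto
  then show ?case by simp
next
  case (And F G)
  have "sat F r \<longleftrightarrow> sat F s" "sat G r \<longleftrightarrow> sat G s"
    using And.prems by (auto intro!: And.IH)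
  then show ?case by simp
next
  case (Or F G)
  have "sat F r \<longleftrightarrow> sat F s" "sat G r \<longleftrightarrow> sat G s"
    using Or.prems by (auto intro!: Or.IH)
  then show ?case by simp
next
  case (Imp F G)
  have "sat F r \<longleftrightarrow> sat F s" "sat G r \<longleftrightarrow> sat G s"
    using Imp.prems by (auto intro!: Imp.IH)
  then show ?case by simp
next
  case (Forall x F)
  have "sat F (r(x := v)) \<longleftrightarrow> sat F (s(x := v))" for v
    using Forall.prems by (intro Forall.IH) auto
  then show ?case by simp
next
  case (Exists x F)
  have "sat F (r(x := v)) \<longleftrightarrow> sat F (s(x := v))" for v
    using Exists.prems by (intro Exists.IH) auto
  then show ?case by simp
qed auto

section \<open>Substitution and the semantics of the derived connectives\<close>

lemma teval_tsubst: "teval (tsubst \<sigma> t) s = teval t (\<lambda>v. teval (\<sigma> v) s)"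
  by (induction t) (auto simp: comp_def cong: map_cong)

lemma tvars_tsubst: "tvars (tsubst \<sigma> t) = (\<Union>v\<in>tvars t. tvars (\<sigma> v))"
  by (induction t) auto

text \<open>The renamed binder \<open>y\<close> avoids the images of all other free variables of
  \<open>F\<close>, so updating \<open>y\<close> affects only the image of \<open>x\<close>. This
  serves both quantifier cases of the substitution lemma.\<close>

lemma sat_subst_bound:
  assumes "y = fresh (\<Union>v\<in>fv F - {x}. tvars (\<sigma> v))"
  shows "sat F (\<lambda>v. teval ((\<sigma>(x := Var y)) v) (s(y := a))) \<longleftrightarrow> sat F ((\<lambda>v. teval (\<sigma> v) s)(x := a))"
proof (rule sat_cong)
  fix v assume "v \<in> fv F"
  have "y \<notin> (\<Union>v\<in>fv F - {x}. tvars (\<sigma> v))"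
    unfolding assms by (rule fresh_notin) auto
  then have "v \<noteq> x \<Longrightarrow> teval (\<sigma> v) (s(y := a)) = teval (\<sigma> v) s"
    using \<open>v \<in> fv F\<close> by (intro teval_cong) auto
  then show "teval ((\<sigma>(x := Var y)) v) (s(y := a)) = ((\<lambda>v. teval (\<sigma> v) s)(x := a)) v"
    by simp
qed

lemma sat_fsubst: "sat (fsubst \<sigma> F) s \<longleftrightarrow> sat F (\<lambda>v. teval (\<sigma> v) s)"
proof (induction F arbitrary: \<sigma> s)
  case (Forall x F)
  show ?case
    by (simp add: Let_def Forall.IH sat_subst_bound[OF refl] del: fun_upd_apply)
next
  case (Exists x F)
  show ?case
    by (simp add: Let_def Exists.IH sat_subst_bound[OF refl] del: fun_upd_apply)
qed (auto simp: teval_tsubst comp_def)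

lemma fv_fsubst: "fv (fsubst \<sigma> F) \<subseteq> (\<Union>v\<in>fv F. tvars (\<sigma> v))"
proof (induction F arbitrary: \<sigma>)
  case (Forall x F)
  show ?case using Forall.IH by (fastforce simp: Let_def split: if_splits)
next
  case (Exists x F)
  show ?case using Exists.IH by (fastforce simp: Let_def split: if_splits)
qed (simp add: tvars_tsubst; blast)+

lemma sat_subst1: "sat (subst1 Q e x) s \<longleftrightarrow> sat Q (s(x := teval e s))"
proof -
  have "(\<lambda>v. teval ((Var(x := e)) v) s) = s(x := teval e s)" by auto
  then show ?thesis by (simp add: subst1_def sat_fsubst)
qed

lemma fv_subst1: "fv (subst1 Q e x) \<subseteq> fv Q \<union> tvars e"
  unfolding subst1_def by (rule order_trans[OF fv_fsubst]) (auto split: if_splits)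

lemma sat_Conj [simp]: "sat (Conj Fs) s \<longleftrightarrow> (\<forall>F\<in>set Fs. sat F s)"
  by (induction Fs) (auto simp: Conj_def)

lemma sat_Disj [simp]: "sat (Disj Fs) s \<longleftrightarrow> (\<exists>F\<in>set Fs. sat F s)"
  by (induction Fs) (auto simp: Disj_def)

lemma fv_Conj [simp]: "fv (Conj Fs) = (\<Union>F\<in>set Fs. fv F)"
  by (induction Fs) (auto simp: Conj_def)

lemma fv_Disj [simp]: "fv (Disj Fs) = (\<Union>F\<in>set Fs. fv F)"
  by (induction Fs) (auto simp: Disj_def)

lemma fv_foldr_Exists [simp]: "fv (foldr Exists zs F) = fv F - set zs"
  by (induction zs) auto

text \<open>Used to read initial ghost values off the existential precondition of an
  invariant-annotated ODE.\<close>

lemma sat_foldr_ExistsD: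
  "sat (foldr Exists zs F) s \<Longrightarrow> \<exists>r. (\<forall>x. x \<notin> set zs \<longrightarrow> r x = s x) \<and> sat F r"
proof (induction zs arbitrary: s)
  case (Cons z zs)
  then obtain v where "sat (foldr Exists zs F) (s(z := v))" by auto
  from Cons.IH[OF this] obtain r where "\<forall>x. x \<notin> set zs \<longrightarrow> r x = (s(z := v)) x" "sat F r"
    by blast
  then show ?case by (intro exI[of _ r]) auto
qed auto

section \<open>Free variables of the verification conditions\<close>

lemma fv_ineq_fm [simp]: "fv (ineq_fm c f) = tvars f"
  by (cases c) auto

lemma fv_inv_fm: "fv (inv_fm i) \<subseteq> (\<Union>f\<in>inv_tms i. tvars f)"
  by (cases i) auto

lemma fv_boundary_fm [simp]: "fv (boundary_fm p) = tvars p"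
  by (auto simp: boundary_fm_def Let_def)

lemma tvars_sol_tm: "tvars (sol_tm E t x) = tvars t \<union> ode_vars E"
  by (auto simp: sol_tm_def Let_def)

lemma fv_at_sol: "fv (at_sol E t Q) \<subseteq> fv Q \<union> tvars t \<union> ode_vars E"
  unfolding at_sol_def
  by (rule order_trans[OF fv_fsubst]) (auto simp: tvars_sol_tm split: if_splits)

lemma fv_if_pre:
  "R \<in> if_pre bs Fs \<Longrightarrow>
   fv R \<subseteq> (\<Union>b\<in>set bs. fv (fst b)) \<union> (\<Union>b\<in>set bs. \<Union>P\<in>snd b. fv P) \<union> (\<Union>P\<in>Fs. fv P)"
proof -
  assume "R \<in> if_pre bs Fs"
  then consider i P where "R = Imp (And (Neg (Disj (map fst (take i bs)))) (fst (bs ! i))) P"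
      "bs ! i \<in> set bs" "P \<in> snd (bs ! i)"
    | P where "R = Imp (Neg (Disj (map fst bs))) P" "P \<in> Fs"
    unfolding if_pre_def by (auto dest: nth_mem)
  then show ?thesis
    by cases (auto dest!: in_set_takeD)
qed

lemma fv_the_invs:
  "fv (Conj (map inv_fm (the_invs is))) \<subseteq> (\<Union>i\<in>set is. \<Union>f\<in>inv_tms i. tvars f)"
  by (auto simp: the_invs_def dest!: subsetD[OF fv_inv_fm])

lemma fv_ode_init:
  assumes "R \<in> ode_init p gs is"
  shows "fv R \<subseteq> tvars p \<union> (fv (Conj (map inv_fm is)) - fst ` set gs)"
  using assms by (auto simp: ode_init_def dom_fm_def split: if_splits)

text \<open>The summand \<open>- W\<close> absorbs the variables introduced by nondeterministic
  assignments, which are chosen outside \<open>W\<close>. Since ghosts lie in \<open>W\<close>, it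
  follows that no ghost enters an intermediate assertion of a sequential composition.\<close>

lemma fv_pre:
  assumes "finite W"
  shows "R \<in> pre W S Q \<Longrightarrow> fv R \<subseteq> fv Q \<union> avars S \<union> - W"
proof (induction S arbitrary: Q R)
  case (AAssign x e)
  then show ?case using fv_subst1[of Q e x] by auto
next
  case (AHavoc x B)
  define y where "y = fresh (W \<union> {x} \<union> fv B \<union> fv Q)"
  have "y \<notin> W \<union> {x} \<union> fv B \<union> fv Q" unfolding y_def using assms by (intro fresh_notin) auto
  moreover have "R = Imp (subst1 B (Var y) x) (subst1 Q (Var y) x)"
    using AHavoc by (simp add: y_def Let_def)
  ultimately show ?case
    using fv_subst1[of B "Var y" x] fv_subst1[of Q "Var y" x] by auto
next
  case (ASeq S T)
  then show ?case by fastforce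
next
  case (ACond bs S)
  have "fv R \<subseteq> (\<Union>(B, T)\<in>set bs. fv B) \<union> (\<Union>(B, T)\<in>set bs. \<Union>P\<in>pre W T Q. fv P) \<union> (\<Union>P\<in>pre W S Q. fv P)"
    using fv_if_pre[of R] ACond.prems by (fastforce simp: case_prod_beta)
  moreover have "fv P \<subseteq> fv Q \<union> avars T \<union> - W" if "(B, T) \<in> set bs" "P \<in> pre W T Q" for B T P
    using ACond.IH(1)[of "(B, T)" T P Q] that by auto
  moreover have "fv P \<subseteq> fv Q \<union> avars S \<union> - W" if "P \<in> pre W S Q" for P
    using ACond.IH(2) that by auto
  ultimately show ?case
    by (intro subsetI) (drule (1) subsetD, fastforce)
next
  case (AChoice S T)
  then show ?case by fastforce
next
  case (AStar S Is)
  from AStar.prems show ?case by auto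
next
  case (AOdeSol E p)
  have "fv (dom_fm p) = tvars p" by (simp add: dom_fm_def)
  then have "fv (at_sol E (Var y) (dom_fm p)) \<subseteq> tvars p \<union> {y} \<union> ode_vars E"
    "fv (at_sol E (Var y) Q) \<subseteq> fv Q \<union> {y} \<union> ode_vars E" for y
    using fv_at_sol[of E "Var y"] by fastforce+
  note fv = this \<open>fv (dom_fm p) = tvars p\<close>
  from AOdeSol obtain t r where "R = Imp (Neg (dom_fm p)) Q \<or> R = Imp (dom_fm p)
      (Forall t (Imp (Less (Const 0) (Var t))
        (Imp
          (And
            (Forall r (Imp (And (Leq (Const 0) (Var r)) (Less (Var r) (Var t)))
              (at_sol E (Var r) (dom_fm p))))
            (Neg (at_sol E (Var t) (dom_fm p))))
          (at_sol E (Var t) Q))))"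
    unfolding pre.simps Let_def by blast
  then have "fv R \<subseteq> fv Q \<union> (ode_vars E \<union> tvars p)"
    using fv(1,2)[of t] fv(1,2)[of r] fv(3) by (elim disjE) (simp_all, blast+)
  then show ?case by auto
next
  case (AOdeInv E p gs "is")
  then consider "R = Imp (Neg (dom_fm p)) Q" | "R \<in> ode_init p gs (the_invs is)" by auto
  then show ?case
  proof cases
    case 2
    have "fv R \<subseteq> tvars p \<union> ((\<Union>i\<in>set is. \<Union>f\<in>inv_tms i. tvars f) - fst ` set gs)"
      using fv_ode_init[OF 2] fv_the_invs[of "is"] by blast
    then show ?thesis by auto
  qed (auto simp: dom_fm_def)
qed auto

section \<open>Executions\<close>

lemma exec_Star_invariant:
  assumes "exec (Star P) s s'" "I s" "\<And>s s'. exec P s s' \<Longrightarrow> I s \<Longrightarrow> I s'"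
  shows "I s'"
  using assms by (induction "Star P" s s' rule: exec.induct) auto

text \<open>Unfolds the nested conditionals produced by \<open>erase\<close> into the index form in
  which \<open>if_pre\<close> states the guards: the branch taken is the first one whose guard is
  true.\<close>

lemma exec_erase_ACond:
  "exec (erase (ACond bs S)) s s' \<Longrightarrow>
   (\<exists>i<length bs. (\<forall>b\<in>set (take i bs). \<not> sat (fst b) s) \<and> sat (fst (bs ! i)) s
      \<and> exec (erase (snd (bs ! i))) s s')
   \<or> (\<forall>b\<in>set bs. \<not> sat (fst b) s) \<and> exec (erase S) s s'"
proof (induction bs)
  case (Cons b bs)
  obtain B R where b: "b = (B, R)" by force
  from Cons.prems have "exec (If B (erase R) (erase (ACond bs S))) s s'" by (simp add: b)
  then show ?case
  proof cases
    case IfTrue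
    then show ?thesis by (auto simp: b intro!: exI[of _ 0])
  next
    case IfFalse
    from Cons.IH[OF IfFalse(2)] show ?thesis
    proof (elim disjE exE conjE)
      fix i assume "i < length bs" "\<forall>b\<in>set (take i bs). \<not> sat (fst b) s" "sat (fst (bs ! i)) s"
        "exec (erase (snd (bs ! i))) s s'"
      then show ?thesis using IfFalse(1) by (intro disjI1 exI[of _ "Suc i"]) (auto simp: b)
    qed (use IfFalse(1) in \<open>auto simp: b\<close>)
  qed
qed auto

lemma exec_Ode_frame: "exec (Ode E p) s s' \<Longrightarrow> x \<notin> fst ` set E \<Longrightarrow> s' x = s x"
  by (erule exec.cases) (auto simp: ode_sol_def)

text \<open>This is what allows the preconditions over never reassigned variables to be assumed in
  every internal condition: they stay true throughout the execution.\<close>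

lemma exec_frame: "exec (erase S) s s' \<Longrightarrow> x \<notin> assigned S \<Longrightarrow> s' x = s x"
proof (induction S arbitrary: s s')
  case (ASeq S T)
  then obtain q where "exec (erase S) s q" "exec (erase T) q s'" by (auto elim: exec.cases)
  with ASeq.IH(1)[of s q] ASeq.IH(2)[of q s'] ASeq.prems(2) show ?case by simp
next
  case (ACond bs S)
  from exec_erase_ACond[OF ACond.prems(1)] show ?case
  proof (elim disjE exE conjE)
    fix i assume "i < length bs" "exec (erase (snd (bs ! i))) s s'"
    moreover from this have "x \<notin> assigned (snd (bs ! i))"
      using ACond.prems(2) nth_mem[of i bs] by (fastforce simp: case_prod_beta)
    ultimately show ?thesis using ACond.IH(1)[of "bs ! i" "snd (bs ! i)"]
      by (auto simp: Basic_BNFs.snds.simps prod_eq_iff)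
  qed (use ACond in auto)
next
  case (AChoice S T)
  then show ?case by (auto elim!: exec.cases[of "Choice _ _"])
next
  case (AStar S Is)
  show ?case
  proof (rule exec_Star_invariant[where I = "\<lambda>r. r x = s x"])
    fix q q' assume "exec (erase S) q q'" "q x = s x"
    with AStar.IH[of q q'] AStar.prems(2) show "q' x = s x" by simp
  qed (use AStar.prems in auto)
qed (auto elim: exec.cases dest: exec_Ode_frame)

section \<open>Polynomials along trajectories\<close>

text \<open>With distinct left-hand sides at most one summand of the Lie derivative of a variable is
  nonzero, namely the one from its own equation.\<close>

lemma teval_lie_Var:
  assumes "distinct (map fst E)"
  shows "teval (lie E (Var y)) s = (case map_of E y of Some e \<Rightarrow> teval e s | None \<Rightarrow> 0)"
proof -
  have "y \<notin> fst ` set E \<Longrightarrow> teval (lie E (Var y)) s = 0" for E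
    by (induction E) (auto simp: lie_def)
  with assms show ?thesis
    by (induction E) (auto simp: lie_def)
qed

text \<open>The chain rule, by structural induction: the Lie derivative is linear and satisfies the
  product rule, just like the time derivative along \<open>h\<close>, and the two agree on
  variables.\<close>

lemma has_real_derivative_teval:
  assumes "distinct (map fst E)" "is_poly f"
    and "\<And>x e. (x, e) \<in> set E \<Longrightarrow> ((\<lambda>r. h r x) has_real_derivative teval e (h t)) (at t within S)"
    and "\<And>x. x \<notin> fst ` set E \<Longrightarrow> ((\<lambda>r. h r x) has_real_derivative 0) (at t within S)"
  shows "((\<lambda>r. teval f (h r)) has_real_derivative teval (lie E f) (h t)) (at t within S)"
  using assms(2)
proof (induction f)
  case (Const c)
  have "teval (lie E (Const c)) (h t) = 0" by (induction E) (auto simp: lie_def)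
  then show ?case by simp
next
  case (Var x)
  show ?case
  proof (cases "map_of E x")
    case None
    then have "x \<notin> fst ` set E" by (simp add: map_of_eq_None_iff)
    with None show ?thesis
      using assms(4)[of x] by (simp add: teval_lie_Var[OF assms(1)])
  next
    case (Some e)
    then show ?thesis
      using assms(3)[OF map_of_SomeD[OF Some]] by (simp add: teval_lie_Var[OF assms(1)])
  qed
next
  case (Add a b)
  have "teval (lie E (Add a b)) (h t) = teval (lie E a) (h t) + teval (lie E b) (h t)"
    by (induction E) (auto simp: lie_def algebra_simps)
  then show ?case using Add by (auto intro!: derivative_intros)
next
  case (Sub a b)
  have "teval (lie E (Sub a b)) (h t) = teval (lie E a) (h t) - teval (lie E b) (h t)"
    by (induction E) (auto simp: lie_def algebra_simps)
  then show ?case using Sub by (auto intro!: derivative_intros)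
next
  case (Mul a b)
  have "teval (lie E (Mul a b)) (h t) =
      teval a (h t) * teval (lie E b) (h t) + teval (lie E a) (h t) * teval b (h t)"
    by (induction E) (auto simp: lie_def algebra_simps)
  then show ?case using Mul by (auto intro!: derivative_eq_intros)
qed auto

lemma continuous_on_teval:
  assumes "is_poly f" "\<And>x. continuous_on S (\<lambda>t. h t x)"
  shows "continuous_on S (\<lambda>t. teval f (h t))"
  using assms by (induction f) (auto intro!: continuous_intros)

lemma ode_sol_0: "ode_sol E s T f \<Longrightarrow> f 0 = s"
  by (simp add: ode_sol_def)

lemma ode_sol_frame: "ode_sol E s T f \<Longrightarrow> t \<in> {0..T} \<Longrightarrow> x \<notin> fst ` set E \<Longrightarrow> f t x = s x"
  by (simp add: ode_sol_def)

lemma ode_sol_frame_deriv: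
  assumes "ode_sol E s T f" "t \<in> {0..T}" "x \<notin> fst ` set E"
  shows "((\<lambda>r. f r x) has_real_derivative 0) (at t within {0..T})"
  unfolding has_field_derivative_def
  \<comment> \<open>The coordinate is known to be constant only on \<open>{0..T}\<close>, so it is
    exchanged for a constant function inside that interval.\<close>
  by (rule has_derivative_transform[OF assms(2), of _ "\<lambda>_. s x"])
    (use assms in \<open>auto simp: ode_sol_def intro!: derivative_eq_intros\<close>)

lemma ode_sol_deriv:
  assumes "ode_sol E s T f" "t \<in> {0..T}" "(x, e) \<in> set E"
  shows "((\<lambda>r. f r x) has_real_derivative teval e (f t)) (at t within {0..T})"
  using assms by (auto simp: ode_sol_def)

lemma continuous_on_ode_sol:
  assumes "ode_sol E s T f"
  shows "continuous_on {0..T} (\<lambda>t. f t x)"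
proof -
  have "\<exists>D. ((\<lambda>r. f r x) has_real_derivative D) (at t within {0..T})" if "t \<in> {0..T}" for t
  proof (cases "x \<in> fst ` set E")
    case True
    then obtain e where "(x, e) \<in> set E" by auto
    from ode_sol_deriv[OF assms that this] show ?thesis by blast
  next
    case False
    from ode_sol_frame_deriv[OF assms that this] show ?thesis by blast
  qed
  then show ?thesis by (meson DERIV_continuous continuous_on_eq_continuous_within)
qed

section \<open>Differential inequalities\<close>

lemma continuous_antiderivative:
  fixes g :: "real \<Rightarrow> real"
  assumes "continuous_on {0..T} g"
  obtains G where "\<And>t. t \<in> {0..T} \<Longrightarrow> (G has_real_derivative g t) (at t within {0..T})"
  using antiderivative_continuous[OF assms] by (metis has_real_derivative_iff_has_vector_derivative)

text \<open>At the ends of the interval the derivative is one-sided; the mean value argument uses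
  two-sided derivatives in the interior and mere continuity at the ends.\<close>

lemma nondecreasing_of_deriv:
  fixes u :: "real \<Rightarrow> real"
  assumes "\<And>t. t \<in> {0..T} \<Longrightarrow> (u has_real_derivative u' t) (at t within {0..T})"
    and "\<And>t. t \<in> {0..T} \<Longrightarrow> 0 \<le> u' t" and "t \<in> {0..T}"
  shows "u 0 \<le> u t"
proof -
  have "u 0 \<le> u t" if "0 < t"
  proof (rule DERIV_nonneg_imp_increasing_open[of 0 t u])
    fix x assume "0 < x" "x < t"
    then have "(u has_real_derivative u' x) (at x)"
      using assms(1)[of x] assms(3) by (simp add: at_within_Icc_at)
    then show "\<exists>y. (u has_real_derivative y) (at x) \<and> 0 \<le> y"
      using assms(2)[of x] assms(3) \<open>0 < x\<close> \<open>x < t\<close> by auto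
  next
    have "continuous_on {0..T} u"
      using assms(1) by (meson DERIV_continuous continuous_on_eq_continuous_within)
    then show "continuous_on {0..t} u"
      using assms(3) by (auto elim: continuous_on_subset)
  qed (use that in auto)
  then show ?thesis using assms(3) by (cases "t = 0") auto
qed

text \<open>For an antiderivative \<open>G\<close> of \<open>g\<close>, the function
  \<open>u t * exp (- G t)\<close> is nondecreasing. The factor obtained is
  \<open>exp (G t - G 0)\<close>; only its positivity matters later, since it carries both strict
  and weak signs from time 0 to time \<open>t\<close>.\<close>

lemma darboux_ineq:
  fixes u :: "real \<Rightarrow> real"
  assumes "\<And>t. t \<in> {0..T} \<Longrightarrow> (u has_real_derivative u' t) (at t within {0..T})"
    and "\<And>t. t \<in> {0..T} \<Longrightarrow> g t * u t \<le> u' t"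
    and "continuous_on {0..T} g" and "t \<in> {0..T}"
  shows "\<exists>c>0. c * u 0 \<le> u t"
proof -
  obtain G where G: "\<And>t. t \<in> {0..T} \<Longrightarrow> (G has_real_derivative g t) (at t within {0..T})"
    using continuous_antiderivative[OF assms(3)] by blast
  have "u 0 * exp (- G 0) \<le> u t * exp (- G t)"
  proof (rule nondecreasing_of_deriv[OF _ _ assms(4)])
    fix t assume t: "t \<in> {0..T}"
    show "((\<lambda>t. u t * exp (- G t)) has_real_derivative (u' t - g t * u t) * exp (- G t)) (at t within {0..T})"
      by (rule derivative_eq_intros G assms(1) t refl)+ (simp add: algebra_simps)
    show "0 \<le> (u' t - g t * u t) * exp (- G t)"
      using assms(2)[OF t] by simp
  qed
  then have "u 0 * exp (- G 0) * exp (G t) \<le> u t * exp (- G t) * exp (G t)"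
    by (rule mult_right_mono) simp
  also have "\<dots> = u t" by (simp add: exp_minus)
  finally show ?thesis by (intro exI[of _ "exp (- G 0) * exp (G t)"]) (simp add: algebra_simps)
qed

text \<open>If \<open>u\<close> were negative at \<open>t\<close>, consider the last time
  \<open>m\<close> before \<open>t\<close> at which it is nonnegative. There \<open>u\<close>
  vanishes, so its derivative is positive and \<open>u\<close> is positive just after
  \<open>m\<close>, contradicting the choice of \<open>m\<close>.\<close>

lemma barrier_nonneg:
  fixes u :: "real \<Rightarrow> real"
  assumes der: "\<And>t. t \<in> {0..T} \<Longrightarrow> (u has_real_derivative u' t) (at t within {0..T})"
    and pos: "\<And>t. t \<in> {0..T} \<Longrightarrow> u t = 0 \<Longrightarrow> 0 < u' t"
    and "0 \<le> u 0" and t: "t \<in> {0..T}"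
  shows "0 \<le> u t"
proof (rule ccontr)
  assume neg: "\<not> 0 \<le> u t"
  have cont: "continuous_on {0..T} u"
    using der by (meson DERIV_continuous continuous_on_eq_continuous_within)
  then have cont_sub: "continuous_on {a..b} u" if "0 \<le> a" "b \<le> T" for a b
    using that by (auto elim: continuous_on_subset)
  define Z where "Z = {r \<in> {0..t}. 0 \<le> u r}"
  have "closed Z" unfolding Z_def
    using cont_sub[of 0 t] t by (intro continuous_on_closed_Collect_le continuous_intros) auto
  then have "compact Z"
    by (auto simp: Z_def compact_eq_bounded_closed intro: bounded_subset[of "{0..t}"])
  moreover have "0 \<in> Z" using assms by (auto simp: Z_def)
  ultimately obtain m where m: "m \<in> Z" "\<And>r. r \<in> Z \<Longrightarrow> r \<le> m"
    by (metis compact_attains_sup empty_iff)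
  then have "m < t" using neg by (auto simp: Z_def less_le)
  \<comment> \<open>A zero between \<open>m\<close> and \<open>t\<close> belongs to
    \<open>Z\<close>, so by maximality it can only be \<open>m\<close> itself.\<close>
  obtain z where z: "m \<le> z" "z \<le> t" "u z = 0"
    using IVT2'[of u t 0 m] neg m \<open>m < t\<close> cont_sub[of m t] t by (auto simp: Z_def)
  then have "z \<in> Z" using m by (auto simp: Z_def)
  with z m have "u m = 0" by (metis antisym)
  have "m \<in> {0..T}" using m t by (auto simp: Z_def)
  from has_real_derivative_pos_inc_right[OF der[OF this] pos[OF this \<open>u m = 0\<close>]]
  obtain d where d: "d > 0" "\<And>h. h > 0 \<Longrightarrow> m + h \<in> {0..T} \<Longrightarrow> h < d \<Longrightarrow> u m < u (m + h)" by auto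
  \<comment> \<open>Small enough for the local increase to apply and for \<open>m + h\<close> not to
    pass \<open>t\<close>.\<close>
  define h where "h = min (d / 2) (t - m)"
  have "h > 0" "h < d" "m + h \<le> t" using d \<open>m < t\<close> by (auto simp: h_def)
  then have "m + h \<in> Z"
    using d(2)[of h] t \<open>m \<in> {0..T}\<close> \<open>u m = 0\<close> by (auto simp: Z_def)
  with m(2) \<open>h > 0\<close> show False by force
qed

text \<open>By the weak version \<open>u\<close> never becomes negative. If it vanished at
  \<open>t\<close>, its positive derivative there would make it negative shortly before
  \<open>t\<close>.\<close>

lemma barrier_pos:
  fixes u :: "real \<Rightarrow> real"
  assumes der: "\<And>t. t \<in> {0..T} \<Longrightarrow> (u has_real_derivative u' t) (at t within {0..T})"
    and pos: "\<And>t. t \<in> {0..T} \<Longrightarrow> u t = 0 \<Longrightarrow> 0 < u' t"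
    and "0 < u 0" and t: "t \<in> {0..T}"
  shows "0 < u t"
proof (rule ccontr)
  assume "\<not> 0 < u t"
  have nonneg: "0 \<le> u r" if "r \<in> {0..T}" for r
    by (rule barrier_nonneg[of T u u']) (use assms that in auto)
  from nonneg[OF t] \<open>\<not> 0 < u t\<close> have "u t = 0" by simp
  with assms(3) t have "0 < t" by (auto simp: less_le)
  from has_real_derivative_pos_inc_left[OF der[OF t] pos[OF t \<open>u t = 0\<close>]]
  obtain d where d: "d > 0" "\<And>h. h > 0 \<Longrightarrow> t - h \<in> {0..T} \<Longrightarrow> h < d \<Longrightarrow> u (t - h) < u t" by auto
  define h where "h = min (d / 2) t"
  have "h > 0" "h < d" "t - h \<in> {0..T}" using d \<open>0 < t\<close> t by (auto simp: h_def)
  then have "u (t - h) < 0" using d(2)[of h] \<open>u t = 0\<close> by auto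
  with nonneg[OF \<open>t - h \<in> {0..T}\<close>] show False by simp
qed

text \<open>Variation of constants: \<open>G\<close> integrates the coefficient \<open>a\<close>,
  and \<open>H\<close> integrates the inhomogeneity divided by the homogeneous solution
  \<open>exp (G t)\<close>.\<close>

lemma linear_ode_exists:
  fixes a b :: "real \<Rightarrow> real"
  assumes "continuous_on {0..T} a" "continuous_on {0..T} b"
  obtains w where "w 0 = w0"
    "\<And>t. t \<in> {0..T} \<Longrightarrow> (w has_real_derivative a t * w t + b t) (at t within {0..T})"
proof -
  obtain G where G: "\<And>t. t \<in> {0..T} \<Longrightarrow> (G has_real_derivative a t) (at t within {0..T})"
    using continuous_antiderivative[OF assms(1)] by blast
  then have "continuous_on {0..T} G"
    by (meson DERIV_continuous continuous_on_eq_continuous_within)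
  then have "continuous_on {0..T} (\<lambda>t. b t * exp (- G t))"
    using assms(2) by (intro continuous_intros)
  then obtain H where H: "\<And>t. t \<in> {0..T} \<Longrightarrow>
      (H has_real_derivative b t * exp (- G t)) (at t within {0..T})"
    using continuous_antiderivative by blast
  define w where "w t = exp (G t) * (w0 * exp (- G 0) + H t - H 0)" for t
  have "(w has_real_derivative a t * w t + b t) (at t within {0..T})" if "t \<in> {0..T}" for t
    unfolding w_def
    by (rule derivative_eq_intros G H that refl)+ (simp add: exp_minus algebra_simps)
  moreover have "w 0 = w0" by (simp add: w_def exp_minus)
  ultimately show ?thesis using that by blast
qed

section \<open>Differential invariants\<close>

lemma state_of_map: "state_of xs (map s xs) = (\<lambda>x. if x \<in> set xs then s x else 0)"
  by (auto simp: state_of_def map_of_zip_map)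

text \<open>On \<open>{0..<T}\<close> the run is inside the domain, so continuity sends the closure
  \<open>{0..T}\<close> of this interval into the closure of the domain.\<close>

lemma domain_run_closure:
  fixes T :: real
  assumes T: "T > 0" and cont: "\<And>x. continuous_on {0..T} (\<lambda>t. h t x)"
    and dom: "\<forall>t\<in>{0..<T}. teval p (h t) < 0" and t: "t \<in> {0..T}"
  shows "sat (closure_fm p) (h t)"
proof -
  \<comment> \<open>\<open>closure_fm\<close> rebuilds a state from the variables of
    \<open>p\<close> alone, with 0 elsewhere, so the run is truncated in the same way. Continuity in
    the product topology is then checked coordinatewise.\<close>
  define k where "k t = (\<lambda>x. if x \<in> tvars p then h t x else 0)" for t
  have "continuous_on {0..T} k" unfolding k_def
  proof (rule continuous_on_coordinatewise_then_product)
    fix i show "continuous_on {0..T} (\<lambda>t. if i \<in> tvars p then h t i else 0)"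
      using cont by (cases "i \<in> tvars p") auto
  qed
  moreover have "teval p (k t) = teval p (h t)" for t
    by (intro teval_cong) (auto simp: k_def)
  with dom have "k ` {0..<T} \<subseteq> closure {s. sat (dom_fm p) s}"
    by (intro order_trans[OF _ closure_subset]) (auto simp: dom_fm_def)
  moreover have "closure {0..<T} = {0..T}" using T by (intro closure_atLeastLessThan) auto
  ultimately have "k ` {0..T} \<subseteq> closure {s. sat (dom_fm p) s}"
    using image_closure_subset[of "{0..<T}" k "closure {s. sat (dom_fm p) s}"] by simp
  then have "k t \<in> closure {s. sat (dom_fm p) s}" using t by auto
  then show ?thesis
    by (simp add: closure_fm_def Let_def comp_def state_of_map k_def)
qed

text \<open>A point outside the domain is not interior to it, so a point of the closure outside the
  domain lies on the frontier. This applies to the end point of a run.\<close>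

lemma boundary_of_closure:
  assumes "sat (closure_fm p) s" "\<not> teval p s < 0"
  shows "sat (boundary_fm p) s"
proof -
  let ?k = "\<lambda>x. if x \<in> tvars p then s x else 0"
  have "teval p ?k = teval p s" by (intro teval_cong) auto
  then have "?k \<notin> interior {s. sat (dom_fm p) s}"
    using assms(2) interior_subset by (fastforce simp: dom_fm_def)
  then show ?thesis using assms(1)
    by (simp add: closure_fm_def boundary_fm_def Let_def comp_def state_of_map frontier_def)
qed

text \<open>The conditions are required only at the states of the trajectory, so that they may
  depend on invariants already established there.\<close>

lemma ode_inv_preserved:
  assumes der: "\<And>f t. is_poly f \<Longrightarrow> t \<in> {0..T} \<Longrightarrow>
      ((\<lambda>r. teval f (h r)) has_real_derivative teval (lie E f) (h t)) (at t within {0..T})"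
    and poly: "\<forall>f\<in>inv_tms i. is_poly f"
    and clos: "\<And>t. t \<in> {0..T} \<Longrightarrow> sat (closure_fm p) (h t)"
    and conds: "\<And>t R. t \<in> {0..T} \<Longrightarrow> R \<in> inv_conds E p i \<Longrightarrow> sat R (h t)"
    and init: "sat (inv_fm i) (h 0)" and t: "t \<in> {0..T}"
  shows "sat (inv_fm i) (h t)"
proof -
  have darboux: "\<exists>c>0. c * teval f (h 0) \<le> teval f (h t)"
    if "is_poly f" "is_poly g"
      "\<And>t. t \<in> {0..T} \<Longrightarrow> teval g (h t) * teval f (h t) \<le> teval (lie E f) (h t)" for f g
  proof (rule darboux_ineq[OF der that(3) _ t])
    show "continuous_on {0..T} (\<lambda>t. teval g (h t))"
      using der[OF that(2)] by (meson DERIV_continuous continuous_on_eq_continuous_within)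
  qed (use that in auto)
  \<comment> \<open>The upper bound comes from the lower bound for \<open>- f\<close>.\<close>
  have darboux_neg: "\<exists>c>0. teval f (h t) \<le> c * teval f (h 0)"
    if "is_poly f" "is_poly g"
      "\<And>t. t \<in> {0..T} \<Longrightarrow> teval (lie E f) (h t) \<le> teval g (h t) * teval f (h t)" for f g
  proof -
    have lie_neg: "teval (lie E (Sub (Const 0) f)) s = - teval (lie E f) s" for s
      by (induction E) (auto simp: lie_def algebra_simps)
    from darboux[of "Sub (Const 0) f" g] show ?thesis using that by (simp add: lie_neg)
  qed
  have ineq: "sat (ineq_fm c f) (h t)"
    if "sat (ineq_fm c f) (h 0)" "\<exists>c>0. c * teval f (h 0) \<le> teval f (h t)" for c f
  proof -
    from that(2) obtain d where d: "d > 0" "d * teval f (h 0) \<le> teval f (h t)" by auto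
    have "0 < teval f (h t)" if "0 < teval f (h 0)"
      using d mult_pos_pos[OF d(1) that] by linarith
    moreover have "0 \<le> teval f (h t)" if "0 \<le> teval f (h 0)"
      using d mult_nonneg_nonneg[of d, OF _ that] by linarith
    ultimately show ?thesis using that(1) by (cases c) auto
  qed
  show ?thesis
  proof (cases i)
    case (InvEq f)
    then have "is_poly f" "\<And>t. t \<in> {0..T} \<Longrightarrow> teval (lie E f) (h t) = 0"
      using poly conds clos by auto
    then show ?thesis
      using darboux[of f "Const 0"] darboux_neg[of f "Const 0"] init InvEq by (auto intro: antisym)
  next
    case (InvIneq c f)
    then have "is_poly f" "\<And>t. t \<in> {0..T} \<Longrightarrow> 0 \<le> teval (lie E f) (h t)"
      using poly conds clos by auto
    then show ?thesis
      using darboux[of f "Const 0"] ineq init InvIneq by auto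
  next
    case (InvNeq f)
    then have "is_poly f" "\<And>t. t \<in> {0..T} \<Longrightarrow> teval (lie E f) (h t) = 0"
      using poly conds clos by auto
    \<comment> \<open>The value at time \<open>t\<close> lies between positive multiples of the
      initial value; whichever sign the latter has, one of the two bounds excludes zero.\<close>
    then obtain c d where "c > 0" "c * teval f (h 0) \<le> teval f (h t)"
       "d > 0" "teval f (h t) \<le> d * teval f (h 0)"
      using darboux[of f "Const 0"] darboux_neg[of f "Const 0"] by auto
    moreover have "0 < c * teval f (h 0) \<or> d * teval f (h 0) < 0"
      using init InvNeq \<open>c > 0\<close> \<open>d > 0\<close> by (auto simp: zero_less_mult_iff mult_less_0_iff)
    ultimately have "teval f (h t) \<noteq> 0" by linarith
    then show ?thesis using InvNeq by simp
  next
    case (DbxEq f g)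
    then have "is_poly f" "is_poly g"
      "\<And>t. t \<in> {0..T} \<Longrightarrow> teval (lie E f) (h t) = teval g (h t) * teval f (h t)"
      using poly conds clos by auto
    then show ?thesis
      using darboux[of f g] darboux_neg[of f g] init DbxEq by (auto intro: antisym)
  next
    case (DbxIneq c f g)
    then have "is_poly f" "is_poly g"
      "\<And>t. t \<in> {0..T} \<Longrightarrow> teval g (h t) * teval f (h t) \<le> teval (lie E f) (h t)"
      using poly conds clos by auto
    then show ?thesis
      using darboux[of f g] ineq init DbxIneq by auto
  next
    case (BcIneq c f)
    then have "is_poly f"
      and pos: "\<And>t. t \<in> {0..T} \<Longrightarrow> teval f (h t) = 0 \<Longrightarrow> 0 < teval (lie E f) (h t)"
      using poly conds clos by auto
    have "0 < teval f (h t)" if "0 < teval f (h 0)"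
      by (rule barrier_pos[of T _ "\<lambda>t. teval (lie E f) (h t)"]) (use der pos \<open>is_poly f\<close> that t in auto)
    moreover have "0 \<le> teval f (h t)" if "0 \<le> teval f (h 0)"
      by (rule barrier_nonneg[of T _ "\<lambda>t. teval (lie E f) (h t)"]) (use der pos \<open>is_poly f\<close> that t in auto)
    ultimately show ?thesis using init BcIneq by (cases c) auto
  qed (use init in auto)
qed

text \<open>The extended system is triangular: \<open>E\<close> mentions no ghost, and each ghost
  equation mentions no ghost but its own. Along the given run \<open>f\<close> every ghost equation
  is therefore a scalar linear equation in time, solvable on all of \<open>{0..T}\<close>. The state
  \<open>r\<close> supplies the initial ghost values.\<close>

lemma ghost_solution:
  assumes sol: "ode_sol E s T f" and gs: "wf_ode gs"
    and lin: "\<forall>(z, e)\<in>set gs. linear_in [z] e \<and> tvars e \<inter> fst ` set gs \<subseteq> {z}"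
    and disj: "fst ` set gs \<inter> ode_vars E = {}"
    and r: "\<forall>x. x \<notin> fst ` set gs \<longrightarrow> r x = s x"
  obtains h where "ode_sol (E @ gs) r T h" "\<And>t x. x \<notin> fst ` set gs \<Longrightarrow> h t x = f t x"
proof -
  have "\<exists>w. w 0 = r z \<and> (\<forall>t\<in>{0..T}.
      (w has_real_derivative teval e ((f t)(z := w t))) (at t within {0..T}))"
    if "(z, e) \<in> set gs" for z e
  proof -
    from lin that obtain c b where cb: "is_poly b" "z \<notin> tvars b" "is_poly c" "z \<notin> tvars c"
      "\<And>s. teval e s = teval c s * s z + teval b s"
      by (fastforce simp: linear_in_def)
    have "continuous_on {0..T} (\<lambda>t. teval c (f t))" "continuous_on {0..T} (\<lambda>t. teval b (f t))"
      using cb by (auto intro!: continuous_on_teval continuous_on_ode_sol[OF sol])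
    then obtain w where w: "w 0 = r z" "\<And>t. t \<in> {0..T} \<Longrightarrow>
      (w has_real_derivative teval c (f t) * w t + teval b (f t)) (at t within {0..T})"
      using linear_ode_exists by blast
    have "teval e ((f t)(z := w t)) = teval c (f t) * w t + teval b (f t)" for t
    proof -
      have "teval c ((f t)(z := w t)) = teval c (f t)" "teval b ((f t)(z := w t)) = teval b (f t)"
        using cb by (auto intro!: teval_cong)
      then show ?thesis using cb(5) by simp
    qed
    with w show ?thesis by auto
  qed
  then have "\<forall>q\<in>set gs. \<exists>w. w 0 = r (fst q) \<and> (\<forall>t\<in>{0..T}.
      (w has_real_derivative teval (snd q) ((f t)(fst q := w t))) (at t within {0..T}))"
    by auto
  from bchoice[OF this] obtain w where "\<forall>q\<in>set gs. w q 0 = r (fst q) \<and> (\<forall>t\<in>{0..T}.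
      (w q has_real_derivative teval (snd q) ((f t)(fst q := w q t))) (at t within {0..T}))"
    by blast
  then have w: "\<And>z e. (z, e) \<in> set gs \<Longrightarrow> w (z, e) 0 = r z"
    "\<And>z e t. (z, e) \<in> set gs \<Longrightarrow> t \<in> {0..T} \<Longrightarrow>
      (w (z, e) has_real_derivative teval e ((f t)(z := w (z, e) t))) (at t within {0..T})"
    by fastforce+
  \<comment> \<open>Ghost coordinates come from the scalar solutions, all others from the original
    run.\<close>
  define h where "h t x = (case map_of gs x of Some e \<Rightarrow> w (x, e) t | None \<Rightarrow> f t x)" for t x
  have h_ghost: "h t z = w (z, e) t" if "(z, e) \<in> set gs" for t z e
    using that gs by (simp add: h_def wf_ode_def)
  have h_other: "h t x = f t x" if "x \<notin> fst ` set gs" for t x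
    using that by (simp add: h_def map_of_eq_None_iff[THEN iffD2])
  have "ode_sol (E @ gs) r T h"
    unfolding ode_sol_def
  proof (intro conjI ballI allI impI)
    show "h 0 = r"
    proof
      fix x show "h 0 x = r x"
      proof (cases "x \<in> fst ` set gs")
        case True
        then show ?thesis using w(1) h_ghost by auto
      next
        case False
        then show ?thesis using h_other r sol by (simp add: ode_sol_def)
      qed
    qed
  next
    fix t q assume t: "t \<in> {0..T}" and q: "q \<in> set (E @ gs)"
    obtain x e where xe: "q = (x, e)" by force
    show "case q of (x, e) \<Rightarrow> ((\<lambda>r. h r x) has_real_derivative teval e (h t)) (at t within {0..T})"
    proof (cases "q \<in> set gs")
      case True
      then have "(x, e) \<in> set gs" by (simp add: xe)
      \<comment> \<open>The scalar solution was built with the other ghosts left as in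
        \<open>f\<close>; replacing them by their solutions does not change \<open>e\<close>, in
        which they do not occur.\<close>
      moreover have "teval e (h t) = teval e ((f t)(x := w (x, e) t))"
        using lin \<open>(x, e) \<in> set gs\<close> h_ghost h_other by (intro teval_cong) fastforce
      ultimately show ?thesis using w(2)[of x e t] t by (simp add: xe h_ghost)
    next
      case False
      with q have E: "(x, e) \<in> set E" by (auto simp: xe)
      with disj have "x \<notin> fst ` set gs" "tvars e \<inter> fst ` set gs = {}"
        by (fastforce simp: ode_vars_def)+
      moreover from this have "teval e (h t) = teval e (f t)"
        using h_other by (intro teval_cong) blast
      ultimately show ?thesis using ode_sol_deriv[OF sol t E] by (simp add: xe h_other)
    qed
  next
    fix t x assume "t \<in> {0..T}" "x \<notin> fst ` set (E @ gs)"
    then show "h t x = r x" using sol h_other r by (auto simp: ode_sol_def image_Un)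
  qed
  with h_other that show ?thesis by blast
qed

text \<open>Differential cuts: once the first \<open>j\<close> invariants hold at all times of the
  run, the premise of the conditions for the next one is true all along the run. The assertion
  \<open>A\<close> remains true because its variables do not evolve.\<close>

lemma ode_invs_run:
  assumes sol: "ode_sol E s T h" and T: "T > 0"
    and wf: "wf_ode E" and poly: "\<forall>i\<in>set is. \<forall>f\<in>inv_tms i. is_poly f"
    and dom: "\<forall>t\<in>{0..<T}. teval p (h t) < 0"
    and A: "fv A \<inter> fst ` set E = {}" "sat A s"
    and vcs: "\<forall>R\<in>C_dC E p is. valid (Imp A R)"
    and init: "sat (Conj (map inv_fm is)) s" and t: "t \<in> {0..T}"
  shows "sat (Conj (map inv_fm is)) (h t) \<and> sat A (h t) \<and> sat (closure_fm p) (h t)"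
proof -
  have A_run: "sat A (h t)" if "t \<in> {0..T}" for t
    using that A sol sat_cong[of A "h t" s] by (force simp: ode_sol_def)
  have clos: "sat (closure_fm p) (h t)" if "t \<in> {0..T}" for t
    using domain_run_closure[OF T continuous_on_ode_sol[OF sol] dom that] .
  have "\<forall>t\<in>{0..T}. sat (Conj (map inv_fm (take j is))) (h t)" if "j \<le> length is" for j
    using that
  proof (induction j)
    case (Suc j)
    then have j: "j < length is" by simp
    have "sat (inv_fm (is ! j)) (h t)" if "t \<in> {0..T}" for t
    proof (rule ode_inv_preserved[where h = h and E = E and p = p and T = T])
      fix f t assume "is_poly f" "t \<in> {0..T}"
      then show "((\<lambda>r. teval f (h r)) has_real_derivative teval (lie E f) (h t)) (at t within {0..T})"
        using wf ode_sol_deriv[OF sol] ode_sol_frame_deriv[OF sol]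
        by (intro has_real_derivative_teval) (auto simp: wf_ode_def)
    next
      show "sat (inv_fm (is ! j)) (h 0)" using init j sol by (auto simp: ode_sol_def)
    next
      fix t R assume "t \<in> {0..T}" "R \<in> inv_conds E p (is ! j)"
      then have "valid (Imp A (Imp (Conj (map inv_fm (take j is))) R))"
        using vcs j by (auto simp: C_dC_def)
      then show "sat R (h t)" using Suc A_run \<open>t \<in> {0..T}\<close> by (auto simp: valid_def)
    qed (use that poly j clos in auto)
    then show ?case using Suc j by (auto simp: take_Suc_conv_app_nth)
  qed auto
  from this[of "length is"] A_run[OF t] clos[OF t] t show ?thesis by simp
qed

text \<open>The state \<open>r\<close> is the final state of the run enriched with final ghost
  values. A sole invariant \<open>false\<close> is excluded because it would have to hold initially;
  hence the exit condition in \<open>C_exec\<close> is available.\<close>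

lemma ode_inv_sound:
  assumes sol: "ode_sol E s T f" and T: "T > 0"
    and wf: "wf_aprog (AOdeInv E p gs is)"
    and disj: "fst ` set gs \<inter> (ode_vars E \<union> tvars p) = {}"
    and dom: "\<forall>t\<in>{0..<T}. teval p (f t) < 0" "\<not> teval p (f T) < 0"
    and A: "fv A \<inter> (fst ` set E \<union> fst ` set gs) = {}" "sat A s"
    and vcs: "\<forall>R\<in>C_dC (E @ gs) p (the_invs is). valid (Imp A R)"
    and init: "\<forall>R\<in>ode_init p gs (the_invs is). sat R s"
  obtains r where "\<And>x. x \<notin> fst ` set gs \<Longrightarrow> r x = f T x" "sat A r" "sat (boundary_fm p) r"
    "sat (Conj (map inv_fm (the_invs is))) r" "the_invs is \<noteq> [InvFalse]"
proof -
  \<comment> \<open>As \<open>T\<close> is positive, the run starts inside the domain, which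
    activates the initial conditions.\<close>
  have "sat (dom_fm p) s" using dom(1) T ode_sol_0[OF sol] by (auto simp: dom_fm_def)
  then obtain r0 where r0: "\<forall>x. x \<notin> fst ` set gs \<longrightarrow> r0 x = s x"
    "sat (Conj (map inv_fm (the_invs is))) r0"
  proof (cases "gs = []")
    case True
    with init \<open>sat (dom_fm p) s\<close> show ?thesis by (intro that[of s]) (auto simp: ode_init_def)
  next
    case False
    with init \<open>sat (dom_fm p) s\<close>
    have "sat (foldr Exists (map fst gs) (Conj (map inv_fm (the_invs is)))) s"
      by (auto simp: ode_init_def simp del: sat_Conj)
    from sat_foldr_ExistsD[OF this] that show ?thesis by (auto simp del: sat_Conj)
  qed
  obtain h where h: "ode_sol (E @ gs) r0 T h" "\<And>t x. x \<notin> fst ` set gs \<Longrightarrow> h t x = f t x"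
    using ghost_solution[OF sol _ _ _ r0(1)] wf disj by auto
  have p_eq: "teval p (h t) = teval p (f t)" for t
    using h(2) disj by (intro teval_cong) blast
  have "fst ` set E \<subseteq> ode_vars E" by (force simp: ode_vars_def)
  then have "wf_ode (E @ gs)" using wf disj by (auto simp: wf_ode_def)
  moreover have "\<forall>i\<in>set (the_invs is). \<forall>f\<in>inv_tms i. is_poly f"
    using wf by (auto simp: the_invs_def)
  moreover have "sat A r0" using A r0(1) sat_cong[of A r0 s] by fastforce
  ultimately have run: "sat (Conj (map inv_fm (the_invs is))) (h T)" "sat A (h T)" "sat (closure_fm p) (h T)"
    using ode_invs_run[OF h(1) T _ _ _ _ _ vcs r0(2)] dom(1) A(1) T
    by (simp_all add: p_eq image_Un del: sat_Conj)
  show ?thesis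
  proof (rule that[of "h T"])
    show "sat (boundary_fm p) (h T)" using run dom(2) by (intro boundary_of_closure) (simp_all add: p_eq)
    show "the_invs is \<noteq> [InvFalse]" using r0(2) by auto
  qed (use h run in auto)
qed

section \<open>Solutions of linear equations\<close>

text \<open>The coefficients contain no evolving variable and so are constant along both runs. The
  difference \<open>d\<close> thus solves a homogeneous system with constant coefficients, and its
  squared norm \<open>V\<close> satisfies \<open>V' t \<le> K * V t\<close> with
  \<open>V 0 = 0\<close>.\<close>

lemma linear_ode_unique:
  assumes lin: "\<forall>(x, e)\<in>set E. linear_in (map fst E) e"
    and f: "ode_sol E s T f" and g: "ode_sol E s T g" and t: "t \<in> {0..T}"
  shows "f t = g t"
proof -
  let ?X = "fst ` set E"
  define d where "d t x = f t x - g t x" for t x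
  have "\<exists>a. \<forall>t\<in>{0..T}. ((\<lambda>r. d r x) has_real_derivative (\<Sum>y\<in>?X. a y * d t y)) (at t within {0..T})"
    if "x \<in> ?X" for x
  proof -
    from that obtain e where e: "(x, e) \<in> set E" by auto
    with lin have "linear_in (map fst E) e" by auto
    then obtain c b where "tvars b \<inter> set (map fst E) = {}"
      "\<forall>y\<in>set (map fst E). is_poly (c y) \<and> tvars (c y) \<inter> set (map fst E) = {}"
      "\<forall>s. teval e s = (\<Sum>y\<in>set (map fst E). teval (c y) s * s y) + teval b s"
      unfolding linear_in_def by blast
    then have cb: "tvars b \<inter> ?X = {}" "\<And>y. y \<in> ?X \<Longrightarrow> tvars (c y) \<inter> ?X = {}"
      "\<And>s. teval e s = (\<Sum>y\<in>?X. teval (c y) s * s y) + teval b s"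
      by auto
    have const: "teval q (f t) = teval q s" "teval q (g t) = teval q s"
      if "tvars q \<inter> ?X = {}" "t \<in> {0..T}" for q t
      using that ode_sol_frame[OF f that(2)] ode_sol_frame[OF g that(2)]
      by (intro teval_cong, blast)+
    have "((\<lambda>r. d r x) has_real_derivative (\<Sum>y\<in>?X. teval (c y) s * d t y)) (at t within {0..T})"
      if t: "t \<in> {0..T}" for t
    proof -
      have "((\<lambda>r. d r x) has_real_derivative teval e (f t) - teval e (g t)) (at t within {0..T})"
        unfolding d_def using ode_sol_deriv[OF f t e] ode_sol_deriv[OF g t e]
        by (rule derivative_intros)
      moreover have "teval e (f t) - teval e (g t) = (\<Sum>y\<in>?X. teval (c y) s * d t y)"
        using cb(1,2) t by (simp add: cb(3) const d_def algebra_simps sum_subtractf)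
      ultimately show ?thesis by simp
    qed
    then show ?thesis by (intro exI[of _ "\<lambda>y. teval (c y) s"] ballI)
  qed
  then have "\<forall>x\<in>?X. \<exists>a. \<forall>t\<in>{0..T}.
      ((\<lambda>r. d r x) has_real_derivative (\<Sum>y\<in>?X. a y * d t y)) (at t within {0..T})"
    by blast
  from bchoice[OF this] obtain a where a: "\<And>x t. x \<in> ?X \<Longrightarrow> t \<in> {0..T} \<Longrightarrow>
      ((\<lambda>r. d r x) has_real_derivative (\<Sum>y\<in>?X. a x y * d t y)) (at t within {0..T})"
    by blast
  define V where "V t = (\<Sum>x\<in>?X. (d t x)\<^sup>2)" for t
  define V' where "V' t = (\<Sum>x\<in>?X. 2 * d t x * (\<Sum>y\<in>?X. a x y * d t y))" for t
  define K where "K = (\<Sum>x\<in>?X. \<Sum>y\<in>?X. 2 * \<bar>a x y\<bar>)"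
  have V': "(V has_real_derivative V' t) (at t within {0..T})" if "t \<in> {0..T}" for t
    unfolding V_def V'_def using a that
    by (auto intro!: derivative_eq_intros sum.cong simp: algebra_simps)
  have le_V: "(d t x)\<^sup>2 \<le> V t" if "x \<in> ?X" for t x
    unfolding V_def using that by (intro member_le_sum) auto
  have bound: "V' t \<le> K * V t" for t
  proof -
    have "V' t = (\<Sum>x\<in>?X. \<Sum>y\<in>?X. 2 * (d t x * (a x y * d t y)))"
      by (simp add: V'_def sum_distrib_left algebra_simps)
    also have "\<dots> \<le> (\<Sum>x\<in>?X. \<Sum>y\<in>?X. 2 * \<bar>a x y\<bar> * V t)"
    proof (intro sum_mono)
      fix x y assume xy: "x \<in> ?X" "y \<in> ?X"
      \<comment> \<open>Each cross term is bounded by the mean of two squares, both at most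
        \<open>V t\<close>; summing the coefficients gives \<open>K\<close>.\<close>
      have "\<bar>d t x * d t y\<bar> \<le> ((d t x)\<^sup>2 + (d t y)\<^sup>2) / 2"
        using sum_squares_bound[of "\<bar>d t x\<bar>" "\<bar>d t y\<bar>"] by (simp add: abs_mult)
      also have "\<dots> \<le> V t" using add_mono[OF le_V[OF xy(1), of t] le_V[OF xy(2), of t]] by simp
      finally have "\<bar>a x y\<bar> * \<bar>d t x * d t y\<bar> \<le> \<bar>a x y\<bar> * V t" by (intro mult_left_mono) auto
      moreover have "d t x * (a x y * d t y) \<le> \<bar>a x y\<bar> * \<bar>d t x * d t y\<bar>"
        using abs_ge_self[of "d t x * (a x y * d t y)"] by (simp add: abs_mult algebra_simps)
      ultimately show "2 * (d t x * (a x y * d t y)) \<le> 2 * \<bar>a x y\<bar> * V t" by simp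
    qed
    also have "\<dots> = K * V t" by (simp add: K_def sum_distrib_right)
    finally show ?thesis .
  qed
  \<comment> \<open>Gronwall's inequality is the Darboux inequality for \<open>- V\<close> with
    constant cofactor \<open>K\<close>.\<close>
  have "\<exists>c>0. c * (- V 0) \<le> - V t"
  proof (rule darboux_ineq[where u' = "\<lambda>t. - V' t" and g = "\<lambda>_. K", OF _ _ _ t])
    show "K * - V t \<le> - V' t" for t using bound[of t] by simp
  qed (use V' in \<open>auto intro!: derivative_intros\<close>)
  moreover have "V 0 = 0" using ode_sol_0[OF f] ode_sol_0[OF g] by (simp add: V_def d_def)
  ultimately have "V t \<le> 0" by auto
  then have "(d t x)\<^sup>2 \<le> 0" if "x \<in> ?X" for x using le_V[OF that, of t] by linarith
  then have "d t x = 0" if "x \<in> ?X" for x using that by simp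
  moreover have "d t x = 0" if "x \<notin> ?X" for x
    using ode_sol_frame[OF f t that] ode_sol_frame[OF g t that] by (simp add: d_def)
  ultimately have "d t x = 0" for x by blast
  then show ?thesis by (simp add: d_def fun_eq_iff)
qed

text \<open>\<open>sol_tm\<close> starts the flow in a state that is 0 outside
  \<open>ode_vars E\<close>, and \<open>flow\<close> considers solutions up to exactly the queried
  time. The run is cut down accordingly in both respects.\<close>

lemma ode_sol_restrict:
  assumes sol: "ode_sol E s T f" and "\<tau> \<le> T"
  shows "ode_sol E (\<lambda>x. if x \<in> ode_vars E then s x else 0) \<tau>
    (\<lambda>t x. if x \<in> ode_vars E then f t x else 0)"
  unfolding ode_sol_def
proof (intro conjI ballI allI impI)
  fix t q assume t: "t \<in> {0..\<tau>}" and q: "q \<in> set E"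
  obtain x e where xe: "q = (x, e)" by force
  then have "insert x (tvars e) \<subseteq> ode_vars E" using q by (force simp: ode_vars_def)
  moreover from this have "teval e (\<lambda>x. if x \<in> ode_vars E then f t x else 0) = teval e (f t)"
    by (intro teval_cong) auto
  moreover have "((\<lambda>r. f r x) has_real_derivative teval e (f t)) (at t within {0..\<tau>})"
    using ode_sol_deriv[OF sol, of t x e] t q xe assms(2)
    by (auto elim: has_field_derivative_subset)
  ultimately show "case q of (x, e) \<Rightarrow>
      ((\<lambda>r. if x \<in> ode_vars E then f r x else 0) has_real_derivative
        teval e (\<lambda>x. if x \<in> ode_vars E then f t x else 0)) (at t within {0..\<tau>})"
    by (simp add: xe)
qed (use assms in \<open>auto simp: ode_sol_def\<close>)

text \<open>The definite description in \<open>flow\<close> is justified here: the truncated run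
  gives existence and linearity gives uniqueness. The state \<open>r\<close> may differ from
  \<open>s\<close> outside the variables of the ODE, as it does at the quantified time
  variables.\<close>

lemma teval_sol_tm:
  assumes lin: "\<forall>(x, e)\<in>set E. linear_in (map fst E) e"
    and sol: "ode_sol E s T f" and \<tau>: "teval t r \<in> {0..T}"
    and r: "\<And>y. y \<in> ode_vars E \<Longrightarrow> r y = s y" and x: "x \<in> fst ` set E"
  shows "teval (sol_tm E t x) r = f (teval t r) x"
proof -
  let ?s = "\<lambda>x. if x \<in> ode_vars E then s x else 0"
  let ?f = "\<lambda>t x. if x \<in> ode_vars E then f t x else 0"
  let ?t = "teval t r"
  have f: "ode_sol E ?s ?t ?f"
    using ode_sol_restrict[OF sol] \<tau> by auto
  have "flow E ?t ?s = ?f ?t"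
    unfolding flow_def
  proof (rule the_equality)
    fix s' assume "\<exists>g. ode_sol E ?s ?t g \<and> g ?t = s'"
    then show "s' = ?f ?t" using linear_ode_unique[OF lin f] \<tau> by force
  qed (use f in blast)
  moreover have "state_of (sorted_list_of_set (ode_vars E)) (map r (sorted_list_of_set (ode_vars E))) = ?s"
    by (auto simp: state_of_map r)
  moreover have "x \<in> ode_vars E" using x by (force simp: ode_vars_def)
  ultimately show ?thesis by (simp add: sol_tm_def Let_def comp_def)
qed

lemma sat_at_sol:
  assumes lin: "\<forall>(x, e)\<in>set E. linear_in (map fst E) e"
    and sol: "ode_sol E s T f" and \<tau>: "teval t r \<in> {0..T}"
    and r: "\<And>y. y \<in> ode_vars E \<Longrightarrow> r y = s y"
  shows "sat (at_sol E t Q) r \<longleftrightarrow> sat Q (\<lambda>x. if x \<in> fst ` set E then f (teval t r) x else r x)"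
proof -
  have "(\<lambda>v. teval (if v \<in> fst ` set E then sol_tm E t v else Var v) r) =
      (\<lambda>x. if x \<in> fst ` set E then f (teval t r) x else r x)"
    using teval_sol_tm[OF assms] by auto
  then show ?thesis by (simp add: at_sol_def sat_fsubst)
qed

text \<open>The quantified duration is instantiated with \<open>T\<close> and the intermediate time
  with each \<open>\<tau>\<close> below \<open>T\<close>. The state \<open>r\<close> need only share
  with \<open>s\<close> the variables of the ODE and its domain, so other values may be
  arbitrary.\<close>

lemma ode_sol_sound:
  assumes W: "finite W"
    and wf: "wf_aprog (AOdeSol E p)" and T: "T > 0" and sol: "ode_sol E s T f"
    and dom: "\<forall>t\<in>{0..<T}. teval p (f t) < 0" "\<not> teval p (f T) < 0"
    and r: "\<And>x. x \<in> ode_vars E \<union> tvars p \<Longrightarrow> r x = s x"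
    and pres: "\<forall>R\<in>pre W (AOdeSol E p) Q. sat R r"
  shows "sat Q (\<lambda>x. if x \<in> fst ` set E then f T x else r x)"
proof -
  let ?V = "W \<union> ode_vars E \<union> tvars p \<union> fv Q"
  define t where "t = fresh ?V"
  define \<rho> where "\<rho> = fresh (?V \<union> {t})"
  have t: "t \<notin> ?V" unfolding t_def using W by (intro fresh_notin) auto
  have \<rho>: "\<rho> \<notin> ?V \<union> {t}" unfolding \<rho>_def using W by (intro fresh_notin) auto
  have lin: "\<forall>(x, e)\<in>set E. linear_in (map fst E) e" using wf by simp
  let ?u = "\<lambda>\<tau> r x. if x \<in> fst ` set E then f \<tau> x else r x"
  have at_sol: "sat (at_sol E (Var y) F) q \<longleftrightarrow> sat F (?u \<tau> q)"
    if "q y = \<tau>" "\<tau> \<in> {0..T}" "\<And>x. x \<in> ode_vars E \<Longrightarrow> q x = s x" for y F q \<tau>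
    unfolding that(1)[symmetric]
    by (rule sat_at_sol[OF lin sol, of "Var y" q F, unfolded teval.simps]) (use that in auto)
  have p_eq: "teval p (?u \<tau> q) = teval p (f \<tau>)"
    if "\<tau> \<in> {0..T}" "\<And>x. x \<in> ode_vars E \<union> tvars p \<Longrightarrow> q x = s x" for \<tau> q
    using ode_sol_frame[OF sol that(1)] that(2) by (intro teval_cong) auto
  have "teval p r = teval p s" using r by (intro teval_cong) auto
  then have "sat (dom_fm p) r" using dom(1) T ode_sol_0[OF sol] by (auto simp: dom_fm_def)
  moreover have "Imp (dom_fm p)
            (Forall t (Imp (Less (Const 0) (Var t))
              (Imp
                (And
                  (Forall \<rho> (Imp (And (Leq (Const 0) (Var \<rho>)) (Less (Var \<rho>) (Var t)))
                    (at_sol E (Var \<rho>) (dom_fm p))))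
                  (Neg (at_sol E (Var t) (dom_fm p))))
                (at_sol E (Var t) Q)))) \<in> pre W (AOdeSol E p) Q"
    by (simp add: Let_def t_def \<rho>_def)
  ultimately have main: "sat (Imp
                (And
                  (Forall \<rho> (Imp (And (Leq (Const 0) (Var \<rho>)) (Less (Var \<rho>) (Var t)))
                    (at_sol E (Var \<rho>) (dom_fm p))))
                  (Neg (at_sol E (Var t) (dom_fm p))))
                (at_sol E (Var t) Q)) (r(t := T))"
    using pres T by fastforce
  have "sat (at_sol E (Var \<rho>) (dom_fm p)) (r(t := T, \<rho> := \<tau>))" if "0 \<le> \<tau>" "\<tau> < T" for \<tau>
  proof -
    have "sat (at_sol E (Var \<rho>) (dom_fm p)) (r(t := T, \<rho> := \<tau>)) \<longleftrightarrow>
        sat (dom_fm p) (?u \<tau> (r(t := T, \<rho> := \<tau>)))"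
      by (rule at_sol) (use that t \<rho> r in auto)
    moreover have "teval p (?u \<tau> (r(t := T, \<rho> := \<tau>))) = teval p (f \<tau>)"
      by (rule p_eq) (use that t \<rho> r in auto)
    then have "sat (dom_fm p) (?u \<tau> (r(t := T, \<rho> := \<tau>))) \<longleftrightarrow> teval p (f \<tau>) < 0"
      by (simp add: dom_fm_def)
    ultimately show ?thesis using dom(1) that by auto
  qed
  moreover have "sat (at_sol E (Var t) F) (r(t := T)) \<longleftrightarrow> sat F (?u T (r(t := T)))" for F
    by (rule at_sol) (use T t r in auto)
  moreover have "teval p (?u T (r(t := T))) = teval p (f T)"
    by (rule p_eq) (use T t r in auto)
  ultimately have "sat Q (?u T (r(t := T)))" using main \<rho> dom(2) by (simp add: dom_fm_def)
  moreover have "sat Q (?u T (r(t := T))) \<longleftrightarrow> sat Q (?u T r)"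
    using t by (intro sat_cong) auto
  ultimately show ?thesis by simp
qed

section \<open>Soundness\<close>

text \<open>
  The quantification over all values outside \<open>W\<close> instantiates the fresh variables introduced by
  nondeterministic assignments.
\<close>

definition holds :: "var set \<Rightarrow> fm \<Rightarrow> state \<Rightarrow> bool" where
  "holds W R s \<longleftrightarrow> (\<forall>r. (\<forall>x\<in>W. r x = s x) \<longrightarrow> sat R r)"

lemma holdsD: "holds W R s \<Longrightarrow> (\<And>x. x \<in> W \<Longrightarrow> r x = s x) \<Longrightarrow> sat R r"
  by (simp add: holds_def)

lemma holds_sat: "holds W R s \<Longrightarrow> sat R s"
  by (simp add: holds_def)

text \<open>The guard reads only variables in \<open>W\<close>, so its truth at \<open>s\<close>
  transfers to every state over which \<open>holds\<close> quantifies.\<close>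

lemma holds_Imp: "holds W (Imp B R) s \<Longrightarrow> fv B \<subseteq> W \<Longrightarrow> sat B s \<Longrightarrow> holds W R s"
  unfolding holds_def using sat_cong[of B] by (metis sat.simps(10) subsetD)

lemma holds_valid_Imp:
  "valid (Imp A (Imp B R)) \<Longrightarrow> fv A \<subseteq> W \<Longrightarrow> fv B \<subseteq> W \<Longrightarrow> sat A s \<Longrightarrow> sat B s \<Longrightarrow> holds W R s"
  unfolding valid_def by (meson holds_Imp holds_def)

text \<open>\<open>G\<close> collects the ghosts of the whole program and stays fixed in the
  induction. The postcondition must avoid \<open>G\<close> but may leave \<open>W\<close>, as
  intermediate preconditions can contain variables from nondeterministic assignments.
  \<open>A\<close> carries the preconditions over variables that are never reassigned.\<close>

lemma soundness:
  assumes W: "finite W" "G \<subseteq> W"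
  shows "wf_aprog S \<Longrightarrow> avars S \<subseteq> W \<Longrightarrow> ghosts S \<subseteq> G \<Longrightarrow> avars S \<inter> G = {} \<Longrightarrow> fv Q \<inter> G = {}
    \<Longrightarrow> fv A \<subseteq> W \<Longrightarrow> fv A \<inter> (G \<union> assigned S) = {} \<Longrightarrow> \<forall>R\<in>vc W S Q. valid (Imp A R)
    \<Longrightarrow> \<forall>R\<in>pre W S Q. holds W R s \<Longrightarrow> sat A s \<Longrightarrow> exec (erase S) s s' \<Longrightarrow> holds W Q s'"
proof (induction S arbitrary: Q s s')
  case ASkip
  then show ?case by (auto elim: exec.cases)
next
  case (AAssign x e)
  from AAssign.prems have s': "s' = s(x := teval e s)" by (auto elim: exec.cases)
  show ?case unfolding holds_def
  proof (intro allI impI)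
    fix r assume r: "\<forall>y\<in>W. r y = s' y"
    \<comment> \<open>Undoing the assignment in \<open>r\<close> gives a state that agrees with
      \<open>s\<close> on \<open>W\<close>.\<close>
    have "sat (subst1 Q e x) (r(x := s x))"
      using AAssign.prems r by (intro holdsD[of W _ s]) (auto simp: s')
    moreover have "teval e (r(x := s x)) = teval e s"
      using AAssign.prems r by (intro teval_cong) (auto simp: s')
    moreover have "r(x := teval e s) = r" using AAssign.prems r by (auto simp: s')
    ultimately show "sat Q r" by (simp add: sat_subst1)
  qed
next
  case (AHavoc x B)
  from AHavoc.prems obtain v where s': "s' = s(x := v)" and B: "sat B s'"
    by (auto elim: exec.cases)
  define y where "y = fresh (W \<union> {x} \<union> fv B \<union> fv Q)"
  have y: "y \<notin> W \<union> {x} \<union> fv B \<union> fv Q"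
    unfolding y_def using W by (intro fresh_notin) auto
  show ?case unfolding holds_def
  proof (intro allI impI)
    fix r assume r: "\<forall>y\<in>W. r y = s' y"
    \<comment> \<open>The old value of \<open>x\<close> is restored and the fresh variable receives
      the chosen value; as \<open>y\<close> is outside \<open>W\<close>, the state still agrees with
      \<open>s\<close> there.\<close>
    define q where "q = r(x := s x, y := v)"
    have "sat (Imp (subst1 B (Var y) x) (subst1 Q (Var y) x)) q"
      using AHavoc.prems r y by (intro holdsD[of W _ s]) (auto simp: s' q_def y_def Let_def)
    moreover have "sat B (q(x := v)) \<longleftrightarrow> sat B s'"
      using AHavoc.prems r y by (intro sat_cong) (auto simp: s' q_def)
    moreover have "sat Q (q(x := v)) \<longleftrightarrow> sat Q r"
      using AHavoc.prems r y by (intro sat_cong) (auto simp: s' q_def)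
    ultimately show "sat Q r" using B by (simp add: sat_subst1 q_def)
  qed
next
  case (ASeq S T)
  from ASeq.prems obtain q where q: "exec (erase S) s q" "exec (erase T) q s'"
    by (auto elim: exec.cases)
  have "holds W R q" if R: "R \<in> pre W T Q" for R
  proof (rule ASeq.IH(1)[OF _ _ _ _ _ _ _ _ _ _ q(1)])
    \<comment> \<open>Any variable of \<open>R\<close> beyond those of \<open>Q\<close> and
      \<open>T\<close> is outside \<open>W\<close>, hence outside \<open>G\<close>.\<close>
    show "fv R \<inter> G = {}" using fv_pre[OF W(1) R] W(2) ASeq.prems by auto
  qed (use ASeq.prems R in auto)
  moreover have "sat A q" using ASeq.prems exec_frame[OF q(1)] sat_cong[of A q s] by fastforce
  ultimately show ?case using ASeq.prems by (intro ASeq.IH(2)[OF _ _ _ _ _ _ _ _ _ _ q(2)]) auto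
next
  case (ACond bs S)
  have B: "fv (fst b) \<subseteq> W" if "b \<in> set bs" for b
    using ACond.prems(2) that by fastforce
  define bps where "bps = map (\<lambda>(B, R). (B, pre W R Q)) bs"
  have fst_bps: "map fst bps = map fst bs" by (simp add: bps_def comp_def split_def)
  have pres: "\<forall>R\<in>if_pre bps (pre W S Q). holds W R s" using ACond.prems by (simp add: bps_def)
  from exec_erase_ACond[OF ACond.prems(11)] show ?case
  proof (elim disjE exE conjE)
    fix i assume i: "i < length bs" "\<forall>b\<in>set (take i bs). \<not> sat (fst b) s" "sat (fst (bs ! i)) s"
      "exec (erase (snd (bs ! i))) s s'"
    obtain b R where bR: "bs ! i = (b, R)" by force
    then have mem: "(b, R) \<in> set bs" using i nth_mem by metis
    have bps_i: "map fst (take i bps) = map fst (take i bs)" "bps ! i = (b, pre W R Q)"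
      using i bR fst_bps by (metis take_map) (simp add: bps_def i bR)
    show ?thesis
    proof (rule ACond.IH(1)[OF mem _ _ _ _ _ _ _ _ _ _ \<open>sat A s\<close>])
      show "\<forall>P\<in>pre W R Q. holds W P s"
      proof
        fix P assume "P \<in> pre W R Q"
        then have "Imp (And (Neg (Disj (map fst (take i bs)))) b) P \<in> if_pre bps (pre W S Q)"
          using i bR bps_i unfolding if_pre_def
          by (intro UnI1 CollectI exI[of _ i] exI[of _ P]) (simp add: bps_def)
        with pres have "holds W (Imp (And (Neg (Disj (map fst (take i bs)))) b) P) s" by blast
        then show "holds W P s"
          by (rule holds_Imp) (use i bR B mem in \<open>force dest: in_set_takeD\<close>)+
      qed
      have "avars R \<subseteq> avars (ACond bs S)" "ghosts R \<subseteq> ghosts (ACond bs S)"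
        "assigned R \<subseteq> assigned (ACond bs S)" "vc W R Q \<subseteq> vc W (ACond bs S) Q"
        using mem by fastforce+
      with ACond.prems show "avars R \<subseteq> W" "ghosts R \<subseteq> G" "avars R \<inter> G = {}"
        "fv A \<inter> (G \<union> assigned R) = {}" "\<forall>P\<in>vc W R Q. valid (Imp A P)"
        by blast+
      show "wf_aprog R" using ACond.prems(1) mem by auto
      show "exec (erase R) s s'" using i bR by simp
    qed (use ACond.prems in auto)
  next
    assume S: "\<forall>b\<in>set bs. \<not> sat (fst b) s" "exec (erase S) s s'"
    show ?thesis
    proof (rule ACond.IH(2)[OF _ _ _ _ _ _ _ _ _ \<open>sat A s\<close> S(2)])
      show "\<forall>P\<in>pre W S Q. holds W P s"
      proof
        fix P assume "P \<in> pre W S Q"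
        then have "Imp (Neg (Disj (map fst bs))) P \<in> if_pre bps (pre W S Q)"
          using fst_bps by (auto simp: if_pre_def)
        with pres have "holds W (Imp (Neg (Disj (map fst bs))) P) s" by blast
        then show "holds W P s"
          by (rule holds_Imp) (use S B in auto)
      qed
    qed (use ACond.prems in auto)
  qed
next
  case (AChoice S T)
  from AChoice.prems(11) have "exec (erase S) s s' \<or> exec (erase T) s s'"
    by (auto elim: exec.cases)
  then show ?case
  proof
    assume *: "exec (erase S) s s'"
    show ?thesis by (rule AChoice.IH(1)[OF _ _ _ _ _ _ _ _ _ _ *]) (use AChoice.prems in auto)
  next
    assume *: "exec (erase T) s s'"
    show ?thesis by (rule AChoice.IH(2)[OF _ _ _ _ _ _ _ _ _ _ *]) (use AChoice.prems in auto)
  qed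
next
  case (AStar S Is)
  have Is: "fv I \<subseteq> W" "fv I \<inter> G = {}" if "I \<in> set Is" for I
    using AStar.prems that by auto
  have "sat A s' \<and> (\<forall>I\<in>set Is. sat I s')"
  proof (rule exec_Star_invariant[where I = "\<lambda>r. sat A r \<and> (\<forall>I\<in>set Is. sat I r)"])
    show "exec (Star (erase S)) s s'" using AStar.prems by simp
    show "sat A s \<and> (\<forall>I\<in>set Is. sat I s)" using AStar.prems holds_sat by auto
  next
    fix q q' assume q: "exec (erase S) q q'" "sat A q \<and> (\<forall>I\<in>set Is. sat I q)"
    have "holds W I q'" if I: "I \<in> set Is" for I
    proof (rule AStar.IH[OF _ _ _ _ _ _ _ _ _ _ q(1)])
      show "\<forall>P\<in>pre W S I. holds W P q"
      proof
        fix P assume "P \<in> pre W S I"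
        then have "valid (Imp A (Imp (Conj Is) P))"
          using AStar.prems(8) I by (auto simp: pres_def)
        then show "holds W P q"
          by (rule holds_valid_Imp) (use AStar.prems q Is in auto)
      qed
    qed (use AStar.prems Is I q in auto)
    moreover have "sat A q'" using AStar.prems q exec_frame[OF q(1)] sat_cong[of A q' q] by fastforce
    ultimately show "sat A q' \<and> (\<forall>I\<in>set Is. sat I q')" using holds_sat by auto
  qed
  moreover have "valid (Imp A (Imp (Conj Is) Q))" using AStar.prems by simp
  ultimately show ?case using AStar.prems Is by (intro holds_valid_Imp[of A "Conj Is"]) auto
next
  case (AOdeSol E p)
  from AOdeSol.prems(11) have "exec (Ode E p) s s'" by simp
  then show ?case
  proof cases
    case OdeSkip
    have "holds W (Imp (Neg (dom_fm p)) Q) s" using AOdeSol.prems(9) by (simp add: Let_def)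
    then have "holds W Q s"
      by (rule holds_Imp) (use AOdeSol.prems(2) OdeSkip in \<open>auto simp: dom_fm_def\<close>)
    then show ?thesis using OdeSkip by simp
  next
    case (OdeRun T f)
    show ?thesis unfolding holds_def
    proof (intro allI impI)
      fix r assume r: "\<forall>y\<in>W. r y = s' y"
      \<comment> \<open>Rewinding the evolving variables of \<open>r\<close> yields a state that
        agrees with \<open>s\<close> on \<open>W\<close> and is carried back to \<open>r\<close> by
        the run.\<close>
      define q where "q x = (if x \<in> fst ` set E then s x else r x)" for x
      have "fst ` set E \<subseteq> ode_vars E" by (force simp: ode_vars_def)
      have q: "q x = s x" if "x \<in> W" for x
        using r that OdeRun(1,2) ode_sol_frame[OF OdeRun(3), of T x] by (simp add: q_def)
      have "sat Q (\<lambda>x. if x \<in> fst ` set E then f T x else q x)"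
      proof (rule ode_sol_sound[OF W(1) _ OdeRun(2,3,4,5)])
        show "\<forall>R\<in>pre W (AOdeSol E p) Q. sat R q"
          using AOdeSol.prems(9) q holdsD by blast
      qed (use AOdeSol.prems q in auto)
      moreover have "(\<lambda>x. if x \<in> fst ` set E then f T x else q x) = r"
        using r OdeRun(1) \<open>fst ` set E \<subseteq> ode_vars E\<close> AOdeSol.prems(2) by (fastforce simp: q_def)
      ultimately show "sat Q r" by simp
    qed
  qed
next
  case (AOdeInv E p gs "is")
  from AOdeInv.prems(11) have "exec (Ode E p) s s'" by simp
  then show ?case
  proof cases
    case OdeSkip
    have "holds W (Imp (Neg (dom_fm p)) Q) s" using AOdeInv.prems(9) by (simp)
    then have "holds W Q s"
      by (rule holds_Imp) (use AOdeInv.prems(2) OdeSkip in \<open>auto simp: dom_fm_def\<close>)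
    then show ?thesis using OdeSkip by simp
  next
    case (OdeRun T f)
    have gs: "fst ` set gs \<subseteq> G" using AOdeInv.prems by simp
    have "fst ` set gs \<inter> (ode_vars E \<union> tvars p) = {}" "fv A \<inter> (fst ` set E \<union> fst ` set gs) = {}"
      "\<forall>R\<in>C_dC (E @ gs) p (the_invs is). valid (Imp A R)"
      "\<forall>R\<in>ode_init p gs (the_invs is). sat R s"
      using AOdeInv.prems(4,7,8,9) gs holds_sat by auto
    from ode_inv_sound[OF OdeRun(3,2) AOdeInv.prems(1) this(1) OdeRun(4,5) this(2) \<open>sat A s\<close> this(3,4)]
    obtain r where r: "\<And>x. x \<notin> fst ` set gs \<Longrightarrow> r x = s' x" "sat A r" "sat (boundary_fm p) r"
      "sat (Conj (map inv_fm (the_invs is))) r" "the_invs is \<noteq> [InvFalse]"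
      using OdeRun(1) by metis
    have "valid (Imp A (Imp (And (Conj (map inv_fm (the_invs is))) (boundary_fm p)) Q))"
      using AOdeInv.prems(8) r(5) by (simp add: C_exec_def)
    then have Q: "holds W Q r"
    proof (rule holds_valid_Imp)
      have "(\<Union>i\<in>set is. \<Union>f\<in>inv_tms i. tvars f) - fst ` set gs \<subseteq> W"
        using AOdeInv.prems(2) by auto
      then have "(\<Union>i\<in>set is. \<Union>f\<in>inv_tms i. tvars f) \<subseteq> W"
        using gs W(2) by blast
      with fv_the_invs[of "is"] AOdeInv.prems(2)
      show "fv (And (Conj (map inv_fm (the_invs is))) (boundary_fm p)) \<subseteq> W" by auto
    qed (use AOdeInv.prems r in auto)
    show ?thesis unfolding holds_def
    proof (intro allI impI)
      fix q assume q: "\<forall>y\<in>W. q y = s' y"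
      \<comment> \<open>The ghosts belong to \<open>W\<close>, so they must take their final values
        from \<open>r\<close> before \<open>Q\<close> can be used; as \<open>Q\<close> contains no
        ghost, the truth value at \<open>q\<close> is the same.\<close>
      have "sat Q (\<lambda>x. if x \<in> fst ` set gs then r x else q x)"
        using q r(1) by (intro holdsD[OF Q]) auto
      moreover have "sat Q (\<lambda>x. if x \<in> fst ` set gs then r x else q x) \<longleftrightarrow> sat Q q"
        using AOdeInv.prems(5) gs by (intro sat_cong) auto
      ultimately show "sat Q q" by simp
    qed
  qed
qed

theorem theorem1:
  fixes T :: aprog and Ps Qs :: "fm list"
  assumes "wf_triple Ps T Qs"
    and "\<forall>R\<in>VC Ps T Qs. valid R"
  shows "hoare (Conj Ps) (erase T) (Conj Qs)"
  unfolding hoare_def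
proof (intro allI impI)
  fix s s' assume s: "sat (Conj Ps) s" and run: "exec (erase T) s s'"
  define W where "W = avars T \<union> ghosts T \<union> (\<Union>P\<in>set Ps. fv P) \<union> (\<Union>Q\<in>set Qs. fv Q)"
  let ?A = "Conj (filter (\<lambda>P. fv P \<inter> assigned T = {}) Ps)"
  have "finite W" by (simp add: W_def)
  have W: "avars T \<subseteq> W" "ghosts T \<subseteq> W" "fv (Conj Ps) \<subseteq> W" "fv ?A \<subseteq> W"
    by (auto simp: W_def)
  have A: "fv ?A \<inter> assigned T = {}" by auto
  have wf: "wf_aprog T" "avars T \<inter> ghosts T = {}" "fv ?A \<inter> ghosts T = {}"
    "\<And>Q. Q \<in> set Qs \<Longrightarrow> fv Q \<inter> ghosts T = {}"
    using assms(1) by (auto simp: wf_triple_def)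
  have "sat Q s'" if Q: "Q \<in> set Qs" for Q
  proof (rule holds_sat, rule soundness[where A = ?A and G = "ghosts T",
        OF \<open>finite W\<close> W(2) wf(1) W(1) subset_refl wf(2) wf(4)[OF Q] W(4) _ _ _ _ run])
    show "fv ?A \<inter> (ghosts T \<union> assigned T) = {}" using A wf(3) by blast
    show "\<forall>R\<in>vc W T Q. valid (Imp ?A R)"
      using assms(2) Q unfolding VC_def W_def[symmetric] Let_def vcs_def by blast
    show "\<forall>R\<in>pre W T Q. holds W R s"
    proof
      fix R assume "R \<in> pre W T Q"
      then have "valid (Imp (Conj Ps) R)"
        using assms(2) Q unfolding VC_def W_def[symmetric] Let_def pres_def by blast
      \<comment> \<open>Validity covers arbitrary values outside \<open>W\<close>, in particular
        those of variables left free by nondeterministic assignments.\<close>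
      then have "holds W (Imp (Conj Ps) R) s" by (simp add: valid_def holds_def)
      then show "holds W R s" by (rule holds_Imp[OF _ W(3) s])
    qed
    show "sat ?A s" using s by simp
  qed
  then show "sat (Conj Qs) s'" by simp
qed

end
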